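(* Let $\mathcal K:=\{g\in\breve{\mathcal C}:\ \sigma(g)\ge\frac15,\ \int g\ge\frac15\}$. Then: (a) $T(\mathcal K)\subseteq\mathcal K\cap\breve{\mathcal D}^\sharp$; (b) for each $f\in\mathcal E$ there exists $n\in\mathbb N$ with $T^nf\in\mathcal K$; (c) $d_1(f,g)\le d_\infty(f,g)\le5\sqrt{d_1(f,g)}$ for all $f,g\in\mathcal K$; (d) the metric spaces $(\mathcal K,d_\infty)$ and $(\mathcal K,d_1)$ are complete; (e) the restriction $T|_{\mathcal K}\colon\mathcal K\to\mathcal K$ is continuous when domain and codomain are each equipped, independently, with $d_\infty$ or $d_1$; (f) every sequence in $(\mathcal K,d_\infty)$ or in $(\mathcal K,d_1)$ has a convergent subsequence.
   Context: "Decreasing" means non-increasing; $\int f:=\int_0^1 f(x)\,dx$. $\mathcal E$: measurable decreasing $f\colon[0,1]\to[0,\infty)$ with $f(0)=1$ and $\int f>0$. $\mathcal C$: continuous $f\in\mathcal E$ with $f(1)=0$; $\breve{\mathcal C}$: convex $f\in\mathcal C$. $\mathcal D$: strictly decreasing $f\in\mathcal C$. $\mathcal D'$: $f\in\mathcal D$ continuously differentiable on $(0,1]$. $\mathcal D^\sharp$: $f\in\mathcal D'$ with $f'(1)=0$ and $\lim_{x\to0}f'(x)$ existing in $(-\infty,0]$; $\breve{\mathcal D}^\sharp:=\mathcal D^\sharp\cap\breve{\mathcal C}$. For $g\in\breve{\mathcal C}$, the stride is $\sigma(g):=\sup\{\alpha\ge0:\ \alpha-x\le\alpha g(x)\ \forall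 x\in[0,1]\}$. For $g\in\mathcal E$, $g^*(y):=\sup\{x\in[0,1]:g(x)\ge y\}$. $T$ on $\mathcal E$: $(Tf)(x)=\frac{\int_x^1f^*}{\int f}$, $T^n=T\circ T^{n-1}$. Metrics on $\mathcal E$: $d_\infty(f,g):=\sup_{x\in[0,1]}|f(x)-g(x)|$ and $d_1(f,g):=\int_0^1|f-g|$. $\mathbb N=\{1,2,\dots\}$. *)

theory Defs
  imports "HOL-Analysis.Analysis"
begin

text \<open>Functions on [0,1] are represented as real \<Rightarrow> real; only values on [0,1] matter.
  Integrals are over [0,1] (bounded monotone functions there are integrable).\<close>

definition intg :: "(real \<Rightarrow> real) \<Rightarrow> real" where
  "intg f = integral {0..1} f"

definition decreasing01 :: "(real \<Rightarrow> real) \<Rightarrow> bool" where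
  "decreasing01 f \<longleftrightarrow> (\<forall>x\<in>{0..1}. \<forall>y\<in>{0..1}. x \<le> y \<longrightarrow> f y \<le> f x)"

definition strictly_decreasing01 :: "(real \<Rightarrow> real) \<Rightarrow> bool" where
  "strictly_decreasing01 f \<longleftrightarrow> (\<forall>x\<in>{0..1}. \<forall>y\<in>{0..1}. x < y \<longrightarrow> f y < f x)"

text \<open>class E (measurability is automatic for monotone functions)\<close>
definition classE :: "(real \<Rightarrow> real) set" where
  "classE = {f. decreasing01 f \<and> (\<forall>x\<in>{0..1}. 0 \<le> f x) \<and> f 0 = 1 \<and> intg f > 0}"

definition classC :: "(real \<Rightarrow> real) set" where
  "classC = {f. f \<in> classE \<and> continuous_on {0..1} f \<and> f 1 = 0}"

definition classC_convex :: "(real \<Rightarrow> real) set" where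
  "classC_convex = {f. f \<in> classC \<and> convex_on {0..1} f}"

definition classD :: "(real \<Rightarrow> real) set" where
  "classD = {f. f \<in> classC \<and> strictly_decreasing01 f}"

definition C1_deriv01 :: "(real \<Rightarrow> real) \<Rightarrow> (real \<Rightarrow> real) \<Rightarrow> bool" where
  "C1_deriv01 f f' \<longleftrightarrow>
     (\<forall>x\<in>{0<..1}. (f has_real_derivative f' x) (at x within {0..1})) \<and> continuous_on {0<..1} f'"

definition classD' :: "(real \<Rightarrow> real) set" where
  "classD' = {f. f \<in> classD \<and> (\<exists>f'. C1_deriv01 f f')}"

definition classD_sharp :: "(real \<Rightarrow> real) set" where
  "classD_sharp = {f. f \<in> classD \<and> (\<exists>f'. C1_deriv01 f f' \<and> f' 1 = 0 \<and>
      (\<exists>L. L \<le> 0 \<and> (f' \<longlongrightarrow> L) (at_right 0)))}"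

definition classD_sharp_convex :: "(real \<Rightarrow> real) set" where
  "classD_sharp_convex = classD_sharp \<inter> classC_convex"

definition stride :: "(real \<Rightarrow> real) \<Rightarrow> real" where
  "stride g = Sup {\<alpha>. \<alpha> \<ge> 0 \<and> (\<forall>x\<in>{0..1}. \<alpha> - x \<le> \<alpha> * g x)}"

definition gstar :: "(real \<Rightarrow> real) \<Rightarrow> real \<Rightarrow> real" where
  "gstar g y = Sup {x\<in>{0..1}. g x \<ge> y}"

definition opT :: "(real \<Rightarrow> real) \<Rightarrow> (real \<Rightarrow> real)" where
  "opT f = (\<lambda>x. integral {x..1} (gstar f) / intg f)"

definition d_inf :: "(real \<Rightarrow> real) \<Rightarrow> (real \<Rightarrow> real) \<Rightarrow> real" where
  "d_inf f g = Sup ((\<lambda>x. \<bar>f x - g x\<bar>) ` {0..1})"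

definition d_1 :: "(real \<Rightarrow> real) \<Rightarrow> (real \<Rightarrow> real) \<Rightarrow> real" where
  "d_1 f g = integral {0..1} (\<lambda>x. \<bar>f x - g x\<bar>)"

definition classK :: "(real \<Rightarrow> real) set" where
  "classK = {g. g \<in> classC_convex \<and> stride g \<ge> 1/5 \<and> intg g \<ge> 1/5}"

definition complete_wrt :: "(real \<Rightarrow> real) set \<Rightarrow> ((real \<Rightarrow> real) \<Rightarrow> (real \<Rightarrow> real) \<Rightarrow> real) \<Rightarrow> bool" where
  "complete_wrt S d \<longleftrightarrow> (\<forall>u. (\<forall>n. u n \<in> S) \<and>
       (\<forall>e>0. \<exists>N. \<forall>m\<ge>N. \<forall>n\<ge>N. d (u m) (u n) < e)
     \<longrightarrow> (\<exists>g\<in>S. (\<lambda>n. d (u n) g) \<longlonglongrightarrow> 0))"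

definition continuous_wrt :: "(real \<Rightarrow> real) set \<Rightarrow> ((real \<Rightarrow> real) \<Rightarrow> (real \<Rightarrow> real) \<Rightarrow> real)
   \<Rightarrow> ((real \<Rightarrow> real) \<Rightarrow> (real \<Rightarrow> real) \<Rightarrow> real) \<Rightarrow> ((real \<Rightarrow> real) \<Rightarrow> (real \<Rightarrow> real)) \<Rightarrow> bool" where
  "continuous_wrt S da db F \<longleftrightarrow> (\<forall>f\<in>S. \<forall>e>0. \<exists>\<delta>>0. \<forall>g\<in>S. da f g < \<delta> \<longrightarrow> db (F f) (F g) < e)"

definition seq_compact_wrt :: "(real \<Rightarrow> real) set \<Rightarrow> ((real \<Rightarrow> real) \<Rightarrow> (real \<Rightarrow> real) \<Rightarrow> real) \<Rightarrow> bool" where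
  "seq_compact_wrt S d \<longleftrightarrow> (\<forall>u. (\<forall>n. u n \<in> S) \<longrightarrow>
      (\<exists>(r::nat\<Rightarrow>nat) g. strict_mono r \<and> g \<in> S \<and> (\<lambda>n. d (u (r n)) g) \<longlonglongrightarrow> 0))"

end

theory Submission
  imports Defs "HOL-Complex_Analysis.Great_Picard"
begin

text \<open>Let \<open>H(x) = \<integral> max 0 (f t - x) dt\<close> be the excess of \<open>f\<close> over \<open>x\<close>. Then \<open>- f\<^sup>*\<close> is a
  subgradient of \<open>H\<close>, so \<open>\<integral>\<^sub>x\<^sup>1 f\<^sup>* = H(x)\<close> and \<open>T f = H / \<integral>f\<close> is convex with stride at least
  \<open>\<integral>f\<close>. Exchanging integrals gives \<open>\<integral>T f = \<integral>f\<^sup>2 / (2 \<integral>f)\<close>, and comparing a convex \<open>g\<close> of stride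
  at least \<open>s \<le> 1/5\<close> with a broken line gives \<open>\<integral>T g \<ge> (51/50) s\<close>. Hence \<open>K\<close> is invariant, and the
  integrals of the iterates of any \<open>f\<close> grow geometrically until they reach 1/5. Members of \<open>K\<close> are
  decreasing and 5-Lipschitz, which yields the comparison of the metrics and, by the
  Arzela-Ascoli theorem, compactness.\<close>

section \<open>Subgradients on the line\<close>

definition subgradient_on :: "real set \<Rightarrow> (real \<Rightarrow> real) \<Rightarrow> (real \<Rightarrow> real) \<Rightarrow> bool" where
  "subgradient_on S F G \<longleftrightarrow> (\<forall>x\<in>S. \<forall>y\<in>S. F x + (y - x) * G x \<le> F y)"

lemma subgradient_onD:
  "subgradient_on S F G \<Longrightarrow> x \<in> S \<Longrightarrow> y \<in> S \<Longrightarrow> F x + (y - x) * G x \<le> F y"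
  by (simp add: subgradient_on_def)

lemma subgradient_on_subset: "subgradient_on T F G \<Longrightarrow> S \<subseteq> T \<Longrightarrow> subgradient_on S F G"
  by (auto simp: subgradient_on_def)

lemma subgradient_on_imp_convex_on:
  assumes "convex S" and subgradient: "subgradient_on S F G"
  shows "convex_on S F"
proof (rule convex_onI)
  fix t x y :: real
  assume t_bounds: "0 < t" "t < 1" and xy_in: "x \<in> S" "y \<in> S"
  define z where "z = (1 - t) *\<^sub>R x + t *\<^sub>R y"
  have z_in: "z \<in> S"
    unfolding z_def using \<open>convex S\<close> xy_in t_bounds by (intro convexD_alt) auto
  have "F z = (1 - t) * (F z + (x - z) * G z) + t * (F z + (y - z) * G z)"
    by (simp add: z_def algebra_simps)
  also have "\<dots> \<le> (1 - t) * F x + t * F y"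
    using t_bounds by (intro add_mono mult_left_mono subgradient_onD[OF subgradient] z_in xy_in) auto
  finally show "F ((1 - t) *\<^sub>R x + t *\<^sub>R y) \<le> (1 - t) * F x + t * F y"
    unfolding z_def .
qed fact

lemma subgradient_on_imp_mono_on:
  assumes "subgradient_on S F G"
  shows "mono_on S G"
proof (rule mono_onI)
  fix x y assume "x \<in> S" "y \<in> S" "x \<le> y"
  then have "0 \<le> (y - x) * (G y - G x)"
    using subgradient_onD[OF assms, of x y] subgradient_onD[OF assms, of y x]
    by (simp add: algebra_simps)
  then show "G x \<le> G y"
    using \<open>x \<le> y\<close> by (cases "x = y") (auto simp: zero_le_mult_iff)
qed

lemma subgradient_on_imp_lipschitz_on:
  assumes subgradient: "subgradient_on S F G" and bound: "\<And>x. x \<in> S \<Longrightarrow> \<bar>G x\<bar> \<le> L" and "0 \<le> L"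
  shows "L-lipschitz_on S F"
proof (rule lipschitz_onI)
  have increment_le: "F u - F v \<le> L * \<bar>u - v\<bar>" if "u \<in> S" "v \<in> S" for u v
  proof -
    have "F u - F v \<le> (u - v) * G u"
      using subgradient_onD[OF subgradient that] by (simp add: algebra_simps)
    also have "\<dots> \<le> \<bar>u - v\<bar> * \<bar>G u\<bar>"
      by (metis abs_ge_self abs_mult)
    also have "\<dots> \<le> \<bar>u - v\<bar> * L"
      by (intro mult_left_mono bound that) auto
    finally show ?thesis
      by (simp add: mult.commute)
  qed
  show "dist (F x) (F y) \<le> L * dist x y" if "x \<in> S" "y \<in> S" for x y
    using increment_le[OF that] increment_le[OF that(2,1)]
    by (simp add: dist_real_def abs_le_iff abs_minus_commute)
qed fact

lemma subgradient_on_imp_DERIV: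
  assumes subgradient: "subgradient_on S F G" and x_in: "x \<in> S"
    and continuity: "continuous (at x within S) G"
  shows "(F has_real_derivative G x) (at x within S)"
  unfolding has_field_derivative_iff
proof (rule LIM_zero_cancel, rule Lim_null_comparison)
  have "\<bar>(F y - F x) / (y - x) - G x\<bar> \<le> \<bar>G y - G x\<bar>" if y_in: "y \<in> S" "y \<noteq> x" for y
  proof -
    have "\<bar>F y - F x - (y - x) * G x\<bar> \<le> (y - x) * (G y - G x)"
      using subgradient_onD[OF subgradient x_in y_in(1)] subgradient_onD[OF subgradient y_in(1) x_in]
      by (simp add: algebra_simps)
    also have "\<dots> \<le> \<bar>y - x\<bar> * \<bar>G y - G x\<bar>"
      by (metis abs_ge_self abs_mult)
    finally have "\<bar>F y - F x - (y - x) * G x\<bar> / \<bar>y - x\<bar> \<le> \<bar>G y - G x\<bar>"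
      using y_in by (simp add: divide_le_eq mult.commute)
    moreover have "(F y - F x) / (y - x) - G x = (F y - F x - (y - x) * G x) / (y - x)"
      using y_in by (simp add: diff_divide_distrib)
    ultimately show ?thesis
      by (simp only: abs_divide)
  qed
  then show "\<forall>\<^sub>F y in at x within S. norm ((F y - F x) / (y - x) - G x) \<le> \<bar>G y - G x\<bar>"
    by (simp add: eventually_at_filter)
  show "((\<lambda>y. \<bar>G y - G x\<bar>) \<longlongrightarrow> 0) (at x within S)"
    using continuity unfolding continuous_within by (intro tendsto_rabs_zero LIM_zero)
qed

lemma subgradient_on_diff_le:
  assumes "subgradient_on S F G" "subgradient_on S H G" "x \<in> S" "y \<in> S"
  shows "(F y - H y) - (F x - H x) \<le> (y - x) * (G y - G x)"
  using subgradient_onD[OF assms(1,4,3)] subgradient_onD[OF assms(2-4)]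
  by (simp add: algebra_simps)

lemma subgradient_on_increment_le:
  assumes F_subgradient: "subgradient_on {a..b} F G" and H_subgradient: "subgradient_on {a..b} H G"
    and "a \<le> b"
  shows "F b - F a \<le> H b - H a"
proof -
  have "(F b - F a) - (H b - H a) \<le> (b - a) * (G b - G a) / real (Suc n)" for n
  proof -
    define h where "h = (b - a) / real (Suc n)"
    define p where "p i = a + real i * h" for i
    have p_ends: "p 0 = a" "p (Suc n) = b"
      by (simp_all add: p_def h_def)
    have p_step: "p (Suc i) - p i = h" for i
      by (simp add: p_def algebra_simps)
    have p_in: "p i \<in> {a..b}" if "i \<le> Suc n" for i
    proof -
      have "0 \<le> h"
        using \<open>a \<le> b\<close> by (simp add: h_def)
      then have "0 \<le> real i * h" "real i * h \<le> real (Suc n) * h"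
        using that by (auto intro: mult_right_mono)
      then show ?thesis
        by (simp add: p_def h_def)
    qed
    have step_le: "(F (p (Suc i)) - H (p (Suc i))) - (F (p i) - H (p i))
        \<le> h * (G (p (Suc i)) - G (p i))" if "i < Suc n" for i
      unfolding p_step[of i, symmetric] using that
      by (intro subgradient_on_diff_le[OF F_subgradient H_subgradient] p_in) auto
    have "(F b - F a) - (H b - H a)
        = (\<Sum>i<Suc n. (F (p (Suc i)) - H (p (Suc i))) - (F (p i) - H (p i)))"
      by (simp only: sum_lessThan_telescope[of "\<lambda>i. F (p i) - H (p i)"] p_ends)
    also have "\<dots> \<le> (\<Sum>i<Suc n. h * (G (p (Suc i)) - G (p i)))"
      by (intro sum_mono step_le) simp
    also have "\<dots> = h * (G b - G a)"
      by (simp only: sum_distrib_left[symmetric] sum_lessThan_telescope[of "\<lambda>i. G (p i)"] p_ends)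
    finally show ?thesis
      by (simp add: h_def)
  qed
  moreover have "(\<lambda>n. (b - a) * (G b - G a) / real (Suc n)) \<longlonglongrightarrow> 0"
    by (intro LIMSEQ_Suc lim_const_over_n)
  ultimately have "(F b - F a) - (H b - H a) \<le> 0"
    by (intro LIMSEQ_le_const) auto
  then show ?thesis
    by simp
qed

lemma subgradient_on_integral:
  assumes mono: "mono_on {a..b} G"
  shows "subgradient_on {a..b} (\<lambda>u. integral {a..u} G) G"
  unfolding subgradient_on_def
proof (intro ballI)
  fix x y assume xy_in: "x \<in> {a..b}" "y \<in> {a..b}"
  have increment: "integral {a..v} G - integral {a..u} G = integral {u..v} G"
    "G integrable_on {u..v}" if "a \<le> u" "u \<le> v" "v \<le> b" for u v
  proof -
    have "G integrable_on {a..v}" and "G integrable_on {u..v}"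
      using that by (auto intro: integrable_on_subinterval[OF integrable_on_mono_on[OF mono]])
    then show "integral {a..v} G - integral {a..u} G = integral {u..v} G" "G integrable_on {u..v}"
      using Henstock_Kurzweil_Integration.integral_combine[of a u v G] that by auto
  qed
  show "integral {a..x} G + (y - x) * G x \<le> integral {a..y} G"
  proof (cases "x \<le> y")
    case True
    then have "integral {x..y} (\<lambda>_. G x) \<le> integral {x..y} G"
      using increment(2)[of x y] xy_in by (intro integral_le mono_onD[OF mono]) auto
    then show ?thesis
      using increment(1)[of x y] xy_in True by simp
  next
    case False
    then have "integral {y..x} G \<le> integral {y..x} (\<lambda>_. G x)"
      using increment(2)[of y x] xy_in by (intro integral_le mono_onD[OF mono]) auto
    then show ?thesis
      using increment(1)[of y x] xy_in False by (simp add: algebra_simps)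
  qed
qed

lemma subgradient_on_has_integral:
  assumes subgradient: "subgradient_on {a..b} F G" and "a \<le> b"
  shows "(G has_integral F b - F a) {a..b}"
proof -
  have mono: "mono_on {a..b} G"
    using subgradient by (rule subgradient_on_imp_mono_on)
  have "F b - F a = integral {a..b} G - integral {a..a} G"
    using subgradient subgradient_on_integral[OF mono] \<open>a \<le> b\<close>
    by (intro antisym subgradient_on_increment_le)
  then show ?thesis
    using integrable_integral[OF integrable_on_mono_on[OF mono]] by simp
qed

section \<open>Convex and decreasing functions on an interval\<close>

lemma convex_on_three_points:
  fixes g :: "real \<Rightarrow> real"
  assumes "convex_on S g" "x \<in> S" "z \<in> S" "x \<le> y" "y \<le> z"
  shows "(z - x) * g y \<le> (z - y) * g x + (y - x) * g z"
proof (cases "x < z")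
  case True
  have "{x..z} \<subseteq> S"
    using assms convex_on_imp_convex[OF assms(1)]
    by (metis atMostAtLeast_subset_convex True)
  then have "convex_on {x..z} g"
    using assms(1) by (auto intro: convex_on_subset)
  then have "g y \<le> (g z - g x) / (z - x) * (y - x) + g x"
    using assms by (intro convex_onD_Icc') auto
  then have "(z - x) * g y \<le> (z - x) * ((g z - g x) / (z - x) * (y - x) + g x)"
    using True by (intro mult_left_mono) auto
  also have "\<dots> = (z - y) * g x + (y - x) * g z"
    using True by (simp add: field_simps)
  finally show ?thesis .
next
  case False
  then have "x = y" "z = y"
    using assms(4,5) by auto
  then show ?thesis
    by simp
qed

lemma convex_on_cong:
  assumes f_convex: "convex_on S f" and eq_on_S: "\<And>x. x \<in> S \<Longrightarrow> f x = g x"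
  shows "convex_on S g"
proof (rule convex_onI)
  show convex_S: "convex S"
    using f_convex by (rule convex_on_imp_convex)
  fix t :: real and x y assume t_bounds: "0 < t" "t < 1" and xy_in: "x \<in> S" "y \<in> S"
  have "(1 - t) *\<^sub>R x + t *\<^sub>R y \<in> S"
    using convex_S xy_in t_bounds by (intro convexD_alt) auto
  then show "g ((1 - t) *\<^sub>R x + t *\<^sub>R y) \<le> (1 - t) * g x + t * g y"
    using convex_onD[OF f_convex, of t x y] t_bounds xy_in by (simp flip: eq_on_S)
qed

lemma convex_antimono_imp_lipschitz_on:
  assumes convexity: "convex_on {a..b} g" and antimonotone: "antimono_on {a..b} g" and "0 \<le> L"
    and ray_le: "\<And>x. x \<in> {a..b} \<Longrightarrow> g a - L * (x - a) \<le> g x"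
  shows "L-lipschitz_on {a..b} g"
proof (rule lipschitz_on_leI)
  fix x y assume xy_in: "x \<in> {a..b}" "y \<in> {a..b}" "x \<le> y"
  have "g x - g y \<le> L * (y - x)"
  proof (cases "y = a")
    case False
    have "(y - a) * (g x - g y) \<le> (y - x) * (g a - g y)"
      using convex_on_three_points[OF convexity, of a y x] xy_in by (simp add: algebra_simps)
    also have "\<dots> \<le> (y - x) * (L * (y - a))"
      using ray_le[OF xy_in(2)] xy_in by (intro mult_left_mono) auto
    finally show ?thesis
      using False xy_in by (simp add: mult.left_commute mult.commute[of "y - x"])
  qed (use xy_in in simp)
  then show "dist (g x) (g y) \<le> L * dist x y"
    using monotone_onD[OF antimonotone xy_in] xy_in by (simp add: dist_real_def)
qed fact

lemma lipschitz_on_diff_antimono: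
  fixes f g :: "real \<Rightarrow> real"
  assumes "antimono_on S f" "antimono_on S g"
    and f_lipschitz: "L-lipschitz_on S f" and g_lipschitz: "L-lipschitz_on S g"
  shows "L-lipschitz_on S (\<lambda>x. f x - g x)"
proof (rule lipschitz_on_leI)
  fix x y assume xy_in: "x \<in> S" "y \<in> S" "x \<le> y"
  then show "dist (f x - g x) (f y - g y) \<le> L * dist x y"
    using lipschitz_onD[OF f_lipschitz xy_in(1,2)] lipschitz_onD[OF g_lipschitz xy_in(1,2)]
      monotone_onD[OF assms(1) xy_in] monotone_onD[OF assms(2) xy_in]
    by (auto simp: dist_real_def abs_if split: if_splits)
qed (rule lipschitz_on_nonneg[OF f_lipschitz])

lemma const_le_integral:
  fixes f :: "real \<Rightarrow> real"
  assumes "f integrable_on {a..b}" "a \<le> b" "\<And>x. x \<in> {a<..<b} \<Longrightarrow> c \<le> f x"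
  shows "c * (b - a) \<le> integral {a..b} f"
proof -
  have "c * (b - a) = integral {a<..<b} (\<lambda>_. c)"
    using assms(2) by (simp flip: integral_open_interval_real)
  also have "\<dots> \<le> integral {a<..<b} f"
    using assms by (intro integral_le) (auto simp: integrable_on_open_interval_real)
  finally show ?thesis
    by (simp add: integral_open_interval_real)
qed

lemma integral_pos:
  fixes f :: "real \<Rightarrow> real"
  assumes "continuous_on {a..b} f" "a < b" "\<And>x. x \<in> {a..b} \<Longrightarrow> 0 \<le> f x" "x \<in> {a..b}" "0 < f x"
  shows "0 < integral {a..b} f"
proof -
  have "integral {a..b} f \<noteq> 0"
    using integral_eq_0_iff[OF assms(1-3)] assms(4,5) by auto
  moreover have "0 \<le> integral {a..b} f"
    using assms by (intro integral_nonneg integrable_continuous_real) auto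
  ultimately show ?thesis
    by simp
qed

text \<open>Within distance \<open>\<bar>h x\<bar> / (2 L)\<close> of \<open>x\<close> the function exceeds \<open>\<bar>h x\<bar> / 2\<close> in absolute value.\<close>

lemma lipschitz_on_square_le_integral:
  fixes h :: "real \<Rightarrow> real"
  assumes h_lipschitz: "L-lipschitz_on {0..1} h" and "0 < L"
    and x_in: "x \<in> {0..1}" and hx_le: "\<bar>h x\<bar> \<le> L"
  shows "(h x)\<^sup>2 \<le> 4 * L * integral {0..1} (\<lambda>t. \<bar>h t\<bar>)"
proof -
  define r where "r = \<bar>h x\<bar> / (2 * L)"
  have r_bounds: "0 \<le> r" "r \<le> 1/2" "L * r = \<bar>h x\<bar> / 2"
    using hx_le \<open>0 < L\<close> by (auto simp: r_def field_simps)
  obtain a b where ab_strip: "{a..b} \<subseteq> {0..1}" "b - a = r" "\<And>t. t \<in> {a<..<b} \<Longrightarrow> \<bar>x - t\<bar> \<le> r"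
  proof (cases "x \<le> 1/2")
    case True
    show ?thesis
      by (rule that[of x "x + r"]) (use True x_in r_bounds in auto)
  next
    case False
    show ?thesis
      by (rule that[of "x - r" x]) (use False x_in r_bounds in auto)
  qed
  have abs_h_integrable: "(\<lambda>t. \<bar>h t\<bar>) integrable_on {0..1}"
    using lipschitz_on_continuous_on[OF h_lipschitz]
    by (intro integrable_continuous_real continuous_intros)
  then have abs_h_integrable_ab: "(\<lambda>t. \<bar>h t\<bar>) integrable_on {a..b}"
    using ab_strip(1) by (rule integrable_on_subinterval)
  have "\<bar>h x\<bar> / 2 * (b - a) \<le> integral {a..b} (\<lambda>t. \<bar>h t\<bar>)"
  proof (rule const_le_integral[OF abs_h_integrable_ab])
    fix t assume t_in: "t \<in> {a<..<b}"
    then have "\<bar>h x - h t\<bar> \<le> L * \<bar>x - t\<bar>"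
      using lipschitz_onD[OF h_lipschitz x_in, of t] ab_strip(1) by (force simp: dist_real_def)
    also have "\<dots> \<le> \<bar>h x\<bar> / 2"
      using ab_strip(3)[OF t_in] \<open>0 < L\<close> r_bounds(3) by (metis mult_left_mono less_imp_le)
    finally show "\<bar>h x\<bar> / 2 \<le> \<bar>h t\<bar>"
      by linarith
  qed (use ab_strip r_bounds in auto)
  also have "\<dots> \<le> integral {0..1} (\<lambda>t. \<bar>h t\<bar>)"
    using ab_strip abs_h_integrable abs_h_integrable_ab by (intro integral_subset_le) auto
  finally show ?thesis
    using \<open>0 < L\<close> by (simp add: ab_strip r_def power2_eq_square field_simps)
qed

lemma decreasing01_iff_antimono_on: "decreasing01 f \<longleftrightarrow> antimono_on {0..1} f"
  by (auto simp: decreasing01_def monotone_on_def)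

lemma decreasing01_integrable:
  assumes "decreasing01 f"
  shows "f integrable_on {0..1}"
proof -
  have "mono_on {0..1} (\<lambda>x. - f x)"
    using assms by (simp add: decreasing01_def mono_on_def)
  then show ?thesis
    using integrable_on_mono_on integrable_neg_iff by blast
qed

lemma convex_imp_strictly_decreasing01:
  assumes convexity: "convex_on {0..1} g" and "g 1 = 0" and pos: "\<And>x. x \<in> {0..<1} \<Longrightarrow> 0 < g x"
  shows "strictly_decreasing01 g"
  unfolding strictly_decreasing01_def
proof (intro ballI impI)
  fix x y :: real assume xy_in: "x \<in> {0..1}" "y \<in> {0..1}" "x < y"
  have "(1 - x) * g y \<le> (1 - y) * g x"
    using convex_on_three_points[OF convexity, of x 1 y] xy_in \<open>g 1 = 0\<close> by simp
  also have "\<dots> < (1 - x) * g x"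
    using pos[of x] xy_in by simp
  finally show "g y < g x"
    using xy_in by simp
qed

section \<open>The layer-cake formula\<close>

lemma
  assumes "f \<in> classE"
  shows classE_decreasing01: "decreasing01 f" and classE_at_0: "f 0 = 1"
    and classE_intg_pos: "intg f > 0" and classE_integrable: "f integrable_on {0..1}"
    and classE_nonneg: "\<And>x. x \<in> {0..1} \<Longrightarrow> 0 \<le> f x"
    and classE_le_1: "\<And>x. x \<in> {0..1} \<Longrightarrow> f x \<le> 1"
proof -
  show decreasing: "decreasing01 f" and f_at_0: "f 0 = 1" and "intg f > 0"
    and "\<And>x. x \<in> {0..1} \<Longrightarrow> 0 \<le> f x"
    using assms by (auto simp: classE_def)
  show "f x \<le> 1" if "x \<in> {0..1}" for x
    using decreasing that f_at_0 by (force simp: decreasing01_def)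
  show "f integrable_on {0..1}"
    using decreasing by (rule decreasing01_integrable)
qed

lemma gstar_bounds:
  assumes "f \<in> classE" "y \<le> 1"
  shows "0 \<le> gstar f y" "gstar f y \<le> 1"
proof -
  have "0 \<in> {x \<in> {0..1}. f x \<ge> y}"
    using assms by (auto simp: classE_def)
  then show "0 \<le> gstar f y" "gstar f y \<le> 1"
    unfolding gstar_def by (auto intro!: cSup_upper cSup_least bdd_aboveI[of _ 1])
qed

lemma le_gstar:
  assumes "t \<in> {0..1}" "y \<le> f t"
  shows "t \<le> gstar f y"
  unfolding gstar_def using assms by (intro cSup_upper) (auto intro!: bdd_aboveI[of _ 1])

lemma le_if_less_gstar:
  assumes f_in: "f \<in> classE" and "y \<le> 1" "0 \<le> t" "t < gstar f y"
  shows "y \<le> f t"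
proof -
  have "0 \<in> {x \<in> {0..1}. y \<le> f x}"
    using classE_at_0[OF f_in] \<open>y \<le> 1\<close> by simp
  then obtain u where "u \<in> {0..1}" "y \<le> f u" "t < u"
    using less_cSupE[OF assms(4)[unfolded gstar_def]] by blast
  moreover have "f u \<le> f t"
    using classE_decreasing01[OF f_in] \<open>0 \<le> t\<close> \<open>t < u\<close> \<open>u \<in> {0..1}\<close>
    by (auto simp: decreasing01_def)
  ultimately show ?thesis
    by simp
qed

definition excess :: "(real \<Rightarrow> real) \<Rightarrow> real \<Rightarrow> real" where
  "excess f x = integral {0..1} (\<lambda>t. max 0 (f t - x))"

lemma excess_integrable:
  assumes "f \<in> classE"
  shows "(\<lambda>t. max 0 (f t - x)) integrable_on {0..1}"
  using classE_decreasing01[OF assms]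
  by (intro decreasing01_integrable) (fastforce simp: decreasing01_def)

lemma excess_0:
  assumes "f \<in> classE"
  shows "excess f 0 = intg f"
  unfolding excess_def intg_def using classE_nonneg[OF assms]
  by (intro Henstock_Kurzweil_Integration.integral_cong) auto

lemma excess_1:
  assumes "f \<in> classE"
  shows "excess f 1 = 0"
proof -
  have "excess f 1 = integral {0..1} (\<lambda>t::real. 0)"
    unfolding excess_def using classE_le_1[OF assms]
    by (intro Henstock_Kurzweil_Integration.integral_cong) auto
  then show ?thesis
    by simp
qed

text \<open>The integrand of \<open>excess f y - excess f x\<close> is at least \<open>x - y\<close> to the left of \<open>f\<^sup>*(x)\<close>,
  where \<open>f \<ge> x\<close>, and nonnegative to the right of it, where \<open>f < x\<close>.\<close>

lemma excess_subgradient: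
  assumes f_in: "f \<in> classE"
  shows "subgradient_on {..1} (excess f) (\<lambda>x. - gstar f x)"
  unfolding subgradient_on_def
proof (intro ballI)
  fix x y :: real assume "x \<in> {..1}"
  then have x_le_1: "x \<le> 1"
    by simp
  define a where "a = gstar f x"
  have a_bounds: "0 \<le> a" "a \<le> 1"
    using gstar_bounds[OF f_in x_le_1] by (simp_all add: a_def)
  define D where "D t = max 0 (f t - y) - max 0 (f t - x)" for t
  have D_integrable: "D integrable_on {0..1}"
    unfolding D_def by (intro integrable_diff excess_integrable f_in)
  then have D_integrable_left: "D integrable_on {0..a}"
    and D_integrable_right: "D integrable_on {a..1}"
    using a_bounds by (auto intro: integrable_on_subinterval)
  have "(x - y) * (a - 0) \<le> integral {0..a} D"
  proof (rule const_le_integral[OF D_integrable_left a_bounds(1)])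
    fix t assume "t \<in> {0<..<a}"
    then have "x \<le> f t"
      using le_if_less_gstar[OF f_in x_le_1, of t] by (simp add: a_def)
    then show "x - y \<le> D t"
      by (simp add: D_def)
  qed
  moreover have "0 * (1 - a) \<le> integral {a..1} D"
  proof (rule const_le_integral[OF D_integrable_right a_bounds(2)])
    fix t assume "t \<in> {a<..<1}"
    then have "\<not> x \<le> f t"
      using le_gstar[of t x f] a_bounds by (auto simp: a_def)
    then show "0 \<le> D t"
      by (simp add: D_def)
  qed
  moreover have "integral {0..a} D + integral {a..1} D = integral {0..1} D"
    using a_bounds D_integrable by (intro Henstock_Kurzweil_Integration.integral_combine) auto
  moreover have "integral {0..1} D = excess f y - excess f x"
    unfolding D_def excess_def by (intro integral_diff excess_integrable f_in)
  ultimately show "excess f x + (y - x) * - gstar f x \<le> excess f y"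
    by (simp add: a_def algebra_simps)
qed

lemma gstar_antimono:
  assumes f_in: "f \<in> classE" and "x \<le> y" "y \<le> 1"
  shows "gstar f y \<le> gstar f x"
  using mono_onD[OF subgradient_on_imp_mono_on[OF excess_subgradient[OF f_in]], of x y] assms(2,3)
  by simp

lemma excess_convex:
  assumes "f \<in> classE"
  shows "convex_on {..1} (excess f)"
  using excess_subgradient[OF assms] by (intro subgradient_on_imp_convex_on) auto

lemma excess_antimono:
  assumes f_in: "f \<in> classE" and "x \<le> y" "y \<le> 1"
  shows "excess f y \<le> excess f x"
  unfolding excess_def using \<open>x \<le> y\<close> by (intro integral_le excess_integrable f_in) auto

lemma excess_lipschitz:
  assumes f_in: "f \<in> classE"
  shows "1-lipschitz_on {..1} (excess f)"
  using gstar_bounds[OF f_in]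
  by (intro subgradient_on_imp_lipschitz_on[OF excess_subgradient[OF f_in]]) auto

lemma intg_minus_le_excess:
  assumes f_in: "f \<in> classE" and "x \<in> {0..1}"
  shows "intg f - x \<le> excess f x"
  using lipschitz_onD[OF excess_lipschitz[OF f_in], of 0 x] excess_0[OF f_in] assms(2)
  by (auto simp: dist_real_def)

lemma integral_gstar:
  assumes f_in: "f \<in> classE" and "x \<le> 1"
  shows "integral {x..1} (gstar f) = excess f x"
proof -
  have "subgradient_on {x..1} (excess f) (\<lambda>y. - gstar f y)"
    using excess_subgradient[OF f_in] by (rule subgradient_on_subset) simp
  then have "((\<lambda>y. - gstar f y) has_integral excess f 1 - excess f x) {x..1}"
    using \<open>x \<le> 1\<close> by (rule subgradient_on_has_integral)
  then have "(gstar f has_integral excess f x) {x..1}"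
    using excess_1[OF f_in] by (simp add: has_integral_neg_iff)
  then show ?thesis
    by (rule integral_unique)
qed

section \<open>Images of the operator are convex of large stride\<close>

lemma opT_eq:
  assumes "f \<in> classE" "x \<in> {0..1}"
  shows "opT f x = excess f x / intg f"
  using assms by (simp add: opT_def integral_gstar)

lemma classC_iff: "f \<in> classC \<longleftrightarrow> decreasing01 f \<and> continuous_on {0..1} f \<and> f 0 = 1 \<and> f 1 = 0"
proof
  assume f_shape: "decreasing01 f \<and> continuous_on {0..1} f \<and> f 0 = 1 \<and> f 1 = 0"
  then have nonneg: "0 \<le> f x" if "x \<in> {0..1}" for x
    using that by (force simp: decreasing01_def)
  then have "0 < intg f"
    unfolding intg_def using f_shape by (intro integral_pos[where x = 0]) auto
  with f_shape nonneg show "f \<in> classC"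
    by (simp add: classC_def classE_def)
qed (auto simp: classC_def classE_def)

lemma
  assumes "g \<in> classC"
  shows classC_imp_classE: "g \<in> classE" and classC_continuous_on: "continuous_on {0..1} g"
    and classC_at_0: "g 0 = 1" and classC_at_1: "g 1 = 0"
  using assms by (auto simp: classC_def classE_def)

lemma
  assumes "g \<in> classC_convex"
  shows classC_convex_imp_classC: "g \<in> classC" and classC_convex_imp_classE: "g \<in> classE"
    and classC_convex_continuous_on: "continuous_on {0..1} g"
    and classC_convex_convex_on: "convex_on {0..1} g"
    and classC_convex_at_0: "g 0 = 1" and classC_convex_at_1: "g 1 = 0"
  using assms by (auto simp: classC_convex_def classC_def classE_def)

lemma opT_in_classC_convex:
  assumes f_in: "f \<in> classE"
  shows "opT f \<in> classC_convex"
proof -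
  define h where "h x = excess f x / intg f" for x
  have h_eq: "h x = opT f x" if "x \<in> {0..1}" for x
    using opT_eq[OF f_in that] by (simp add: h_def)
  have intg_pos: "intg f > 0"
    by (rule classE_intg_pos[OF f_in])
  have "decreasing01 h"
    unfolding decreasing01_def h_def using intg_pos excess_antimono[OF f_in]
    by (auto intro: divide_right_mono)
  then have opT_decreasing: "decreasing01 (opT f)"
    by (simp add: decreasing01_def h_eq)
  have "continuous_on {0..1} h"
    unfolding h_def using intg_pos lipschitz_on_continuous_on[OF excess_lipschitz[OF f_in]]
    by (auto intro!: continuous_intros elim: continuous_on_subset)
  then have opT_continuous: "continuous_on {0..1} (opT f)"
    by (rule continuous_on_eq) (rule h_eq)
  have "convex_on {0..1} h"
    unfolding h_def using intg_pos
    by (intro convex_on_cdiv convex_on_subset[OF excess_convex[OF f_in]]) auto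
  then have opT_convex: "convex_on {0..1} (opT f)"
    by (rule convex_on_cong) (rule h_eq)
  have "opT f 0 = 1" "opT f 1 = 0"
    using h_eq[of 0] h_eq[of 1] intg_pos excess_0[OF f_in] excess_1[OF f_in]
    by (simp_all add: h_def)
  with opT_decreasing opT_continuous opT_convex show ?thesis
    by (simp add: classC_convex_def classC_iff)
qed

lemma stride_le:
  assumes "x \<in> {0..1}" "g x < 1"
  shows "stride g \<le> x / (1 - g x)"
  unfolding stride_def
proof (rule cSup_least)
  show "{\<alpha>. \<alpha> \<ge> 0 \<and> (\<forall>x\<in>{0..1}. \<alpha> - x \<le> \<alpha> * g x)} \<noteq> {}"
    by (auto intro: exI[of _ 0])
next
  fix \<alpha> assume "\<alpha> \<in> {\<alpha>. \<alpha> \<ge> 0 \<and> (\<forall>x\<in>{0..1}. \<alpha> - x \<le> \<alpha> * g x)}"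
  then show "\<alpha> \<le> x / (1 - g x)"
    using assms by (auto simp: field_simps)
qed

lemma le_stride:
  assumes "g 1 = 0" "s > 0" and ray_le: "\<And>x. x \<in> {0..1} \<Longrightarrow> 1 - x / s \<le> g x"
  shows "s \<le> stride g"
  unfolding stride_def
proof (rule cSup_upper)
  show "s \<in> {\<alpha>. \<alpha> \<ge> 0 \<and> (\<forall>x\<in>{0..1}. \<alpha> - x \<le> \<alpha> * g x)}"
    using ray_le \<open>s > 0\<close> by (simp add: field_simps)
  show "bdd_above {\<alpha>. \<alpha> \<ge> 0 \<and> (\<forall>x\<in>{0..1}. \<alpha> - x \<le> \<alpha> * g x)}"
    using \<open>g 1 = 0\<close> by (intro bdd_aboveI[of _ 1]) (auto dest!: bspec[of _ _ 1])
qed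

lemma stride_ge_iff:
  assumes "g 1 = 0" "s > 0"
  shows "s \<le> stride g \<longleftrightarrow> (\<forall>x\<in>{0..1}. 1 - x / s \<le> g x)"
proof
  assume s_le: "s \<le> stride g"
  show "\<forall>x\<in>{0..1}. 1 - x / s \<le> g x"
  proof
    fix x :: real assume x_in: "x \<in> {0..1}"
    show "1 - x / s \<le> g x"
    proof (cases "g x < 1")
      case True
      then have "s \<le> x / (1 - g x)"
        using s_le stride_le[of x g] x_in by linarith
      then show ?thesis
        using True \<open>s > 0\<close> by (simp add: field_simps)
    next
      case False
      moreover have "0 \<le> x / s"
        using x_in \<open>s > 0\<close> by simp
      ultimately show ?thesis
        by linarith
    qed
  qed
qed (use le_stride[of g s] assms in blast)

lemma intg_le_stride_opT:
  assumes f_in: "f \<in> classE"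
  shows "intg f \<le> stride (opT f)"
proof -
  have intg_pos: "intg f > 0"
    by (rule classE_intg_pos[OF f_in])
  have "1 - x / intg f \<le> opT f x" if x_in: "x \<in> {0..1}" for x
    using divide_right_mono[OF intg_minus_le_excess[OF f_in x_in], of "intg f"] intg_pos
      opT_eq[OF f_in x_in]
    by (simp add: diff_divide_distrib)
  then show ?thesis
    using classC_convex_at_1[OF opT_in_classC_convex[OF f_in]] intg_pos by (intro le_stride)
qed

lemma classC_convex_lipschitz:
  assumes g_in: "g \<in> classC_convex" and "0 < s" "s \<le> stride g"
  shows "(1 / s)-lipschitz_on {0..1} g"
proof (rule convex_antimono_imp_lipschitz_on)
  note g_classE = classC_convex_imp_classE[OF g_in]
    and g_at_0 = classC_convex_at_0[OF g_in]
    and g_at_1 = classC_convex_at_1[OF g_in]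
  show "antimono_on {0..1} g"
    using classE_decreasing01[OF g_classE] by (simp add: decreasing01_iff_antimono_on)
  show "g 0 - 1 / s * (x - 0) \<le> g x" if "x \<in> {0..1}" for x
    using stride_ge_iff[of g s] assms that g_at_0 g_at_1 by simp
qed (use assms(2) classC_convex_convex_on[OF g_in] in auto)

section \<open>Regularity of the image of the operator\<close>

lemma gstar_attained:
  assumes g_in: "g \<in> classC" and y_in: "y \<in> {0..1}"
  shows "g (gstar g y) = y"
proof (rule antisym)
  note g_classE = classC_imp_classE[OF g_in]
    and g_continuous = classC_continuous_on[OF g_in]
    and g_at_0 = classC_at_0[OF g_in]
    and g_at_1 = classC_at_1[OF g_in]
  let ?A = "{x \<in> {0..1}. y \<le> g x}"
  have "closed ?A"
    by (intro continuous_on_closed_Collect_le continuous_intros g_continuous)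
  moreover have "0 \<in> ?A"
    using g_at_0 y_in by auto
  moreover have "bdd_above ?A"
    by (auto intro!: bdd_aboveI[of _ 1])
  ultimately have gstar_mem: "gstar g y \<in> ?A"
    unfolding gstar_def using closed_contains_Sup[of ?A] by blast
  then show "y \<le> g (gstar g y)"
    by simp
  obtain x where x_preimage: "0 \<le> x" "x \<le> 1" "g x = y"
    using IVT2'[of g 1 y 0] g_continuous g_at_0 g_at_1 y_in by auto
  then have "x \<le> gstar g y"
    by (intro le_gstar) auto
  then show "g (gstar g y) \<le> y"
    using classE_decreasing01[OF g_classE] x_preimage gstar_mem by (auto simp: decreasing01_def)
qed

lemma gstar_1:
  assumes g_in: "g \<in> classC_convex"
  shows "gstar g 1 = 0"
proof -
  note g_classE = classC_convex_imp_classE[OF g_in]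
    and g_classC = classC_convex_imp_classC[OF g_in]
    and g_convex = classC_convex_convex_on[OF g_in]
    and g_at_0 = classC_convex_at_0[OF g_in]
    and g_at_1 = classC_convex_at_1[OF g_in]
  have "gstar g 1 \<in> {0..1}"
    using gstar_bounds[OF g_classE, of 1] by simp
  then have "g (gstar g 1) \<le> 1 - gstar g 1"
    using convex_on_three_points[OF g_convex, of 0 1 "gstar g 1"] g_at_0 g_at_1 by simp
  then show ?thesis
    using gstar_attained[OF g_classC, of 1] gstar_bounds[OF g_classE, of 1] by simp
qed

lemma gstar_lipschitz:
  assumes g_in: "g \<in> classC_convex" and a_pos: "0 < a"
  shows "(1 / a)-lipschitz_on {a..1} (gstar g)"
proof (rule lipschitz_on_leI)
  fix y z assume yz_in: "y \<in> {a..1}" "z \<in> {a..1}" "y \<le> z"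
  note g_classE = classC_convex_imp_classE[OF g_in]
    and g_classC = classC_convex_imp_classC[OF g_in]
    and g_convex = classC_convex_convex_on[OF g_in]
    and g_at_1 = classC_convex_at_1[OF g_in]
  define u v where "u = gstar g y" and "v = gstar g z"
  have uv_levels: "0 \<le> v" "v \<le> u" "u \<le> 1" "g u = y" "g v = z"
    using yz_in a_pos gstar_attained[OF g_classC] gstar_bounds[OF g_classE]
      gstar_antimono[OF g_classE, of y z]
    by (auto simp: u_def v_def)
  have "a * (u - v) \<le> y * (u - v)"
    using yz_in uv_levels by (intro mult_right_mono) auto
  also have "\<dots> \<le> (1 - u) * (z - y)"
    using convex_on_three_points[OF g_convex, of v 1 u] uv_levels g_at_1
    by (simp add: algebra_simps)
  also have "\<dots> \<le> 1 * (z - y)"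
    using uv_levels yz_in by (intro mult_right_mono) auto
  finally show "dist (gstar g y) (gstar g z) \<le> 1 / a * dist y z"
    using a_pos uv_levels(2) yz_in(3) by (simp add: dist_real_def field_simps flip: u_def v_def)
qed (use a_pos in simp)

lemma gstar_continuous_within:
  assumes g_in: "g \<in> classC_convex" and y_in: "y \<in> {0<..1}"
  shows "continuous (at y within {..1}) (gstar g)"
proof -
  have "(1 / (y / 2))-lipschitz_on {y / 2..1} (gstar g)"
    using y_in by (intro gstar_lipschitz[OF g_in]) simp
  then have "continuous (at y within {y / 2..1}) (gstar g)"
    using y_in by (intro continuous_on_imp_continuous_within lipschitz_on_continuous_on) auto
  moreover have "at y within {..1} = at y within {y / 2..1}"
    using y_in by (intro at_within_nhd[of _ "{y / 2<..}"]) auto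
  ultimately show ?thesis
    by simp
qed

lemma opT_DERIV:
  assumes g_in: "g \<in> classC_convex" and x_in: "x \<in> {0<..1}"
  shows "(opT g has_real_derivative - gstar g x / intg g) (at x within {0..1})"
proof (rule has_field_derivative_transform_within)
  note g_classE = classC_convex_imp_classE[OF g_in]
  have "(excess g has_real_derivative - gstar g x) (at x within {..1})"
    using x_in gstar_continuous_within[OF g_in x_in]
    by (intro subgradient_on_imp_DERIV[OF excess_subgradient[OF g_classE]] continuous_minus) auto
  then show "((\<lambda>x. excess g x / intg g) has_real_derivative - gstar g x / intg g)
      (at x within {0..1})"
    by (intro DERIV_cdivide) (auto elim: DERIV_subset)
  show "excess g y / intg g = opT g y" if "y \<in> {0..1}" for y
    using opT_eq[OF g_classE that] by simp
qed (use x_in in auto)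

lemma opT_C1_deriv01:
  assumes g_in: "g \<in> classC_convex"
  shows "C1_deriv01 (opT g) (\<lambda>x. - gstar g x / intg g)"
proof -
  have "continuous_on {0<..1} (gstar g)"
    unfolding continuous_on_eq_continuous_within
    by (auto intro: continuous_within_subset[OF gstar_continuous_within[OF g_in]])
  moreover have "intg g > 0"
    using classC_convex_imp_classE[OF g_in] by (rule classE_intg_pos)
  ultimately have "continuous_on {0<..1} (\<lambda>x. - gstar g x / intg g)"
    by (intro continuous_intros) auto
  then show ?thesis
    using opT_DERIV[OF g_in] by (simp add: C1_deriv01_def)
qed

lemma gstar_tendsto_at_right_0:
  assumes f_in: "f \<in> classE"
  shows "\<exists>L\<ge>0. (gstar f \<longlongrightarrow> L) (at_right 0)"
proof -
  have "((\<lambda>y. - gstar f y) \<longlongrightarrow> Inf ((\<lambda>y. - gstar f y) ` ({0<..} \<inter> {..1})))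
      (at 0 within {0<..} \<inter> {..1})"
    using gstar_antimono[OF f_in] gstar_bounds[OF f_in]
    by (intro Lim_right_bound[where K = "-1"]) auto
  moreover have "at 0 within ({0<..} \<inter> {..1}) = at_right (0 :: real)"
    by (intro at_within_nhd[of _ "{..<1}"]) auto
  ultimately obtain L where "((\<lambda>y. - gstar f y) \<longlongrightarrow> L) (at_right 0)"
    by metis
  then have lim: "(gstar f \<longlongrightarrow> - L) (at_right 0)"
    using tendsto_minus by fastforce
  moreover have "0 \<le> - L"
  proof (rule tendsto_lowerbound[OF lim])
    show "\<forall>\<^sub>F y in at_right 0. 0 \<le> gstar f y"
      using eventually_at_right_real[OF zero_less_one]
      by eventually_elim (simp add: gstar_bounds[OF f_in])
  qed simp
  ultimately show ?thesis
    by blast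
qed

lemma opT_strictly_decreasing01:
  assumes g_in: "g \<in> classC"
  shows "strictly_decreasing01 (opT g)"
proof (rule convex_imp_strictly_decreasing01)
  note g_classE = classC_imp_classE[OF g_in]
  show "convex_on {0..1} (opT g)" "opT g 1 = 0"
    using opT_in_classC_convex[OF g_classE]
    by (auto intro: classC_convex_convex_on classC_convex_at_1)
  show "0 < opT g x" if x_in: "x \<in> {0..<1}" for x
  proof -
    have "0 < excess g x"
      unfolding excess_def using classC_continuous_on[OF g_in] classC_at_0[OF g_in] x_in
      by (intro integral_pos[where x = 0] continuous_intros) auto
    then show ?thesis
      using opT_eq[OF g_classE, of x] classE_intg_pos[OF g_classE] x_in by simp
  qed
qed

lemma opT_in_classD_sharp_convex:
  assumes g_in: "g \<in> classC_convex"
  shows "opT g \<in> classD_sharp_convex"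
proof -
  note g_classE = classC_convex_imp_classE[OF g_in]
    and g_classC = classC_convex_imp_classC[OF g_in]
  have intg_pos: "intg g > 0"
    by (rule classE_intg_pos[OF g_classE])
  obtain L where "L \<ge> 0" "(gstar g \<longlongrightarrow> L) (at_right 0)"
    using gstar_tendsto_at_right_0[OF g_classE] by blast
  then have "- L / intg g \<le> 0" "((\<lambda>x. - gstar g x / intg g) \<longlongrightarrow> - L / intg g) (at_right 0)"
    using intg_pos by (auto intro!: tendsto_intros)
  moreover have "- gstar g 1 / intg g = 0"
    by (simp add: gstar_1[OF g_in])
  ultimately have "\<exists>h. C1_deriv01 (opT g) h \<and> h 1 = 0 \<and> (\<exists>L\<le>0. (h \<longlongrightarrow> L) (at_right 0))"
    using opT_C1_deriv01[OF g_in] by blast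
  then show ?thesis
    using opT_in_classC_convex[OF g_classE] opT_strictly_decreasing01[OF g_classC]
    by (simp add: classD_sharp_convex_def classD_sharp_def classD_def classC_convex_def)
qed

section \<open>Growth of the integral\<close>

lemma integral_hinge:
  fixes a :: real
  assumes "0 \<le> a" "a \<le> 1"
  shows "integral {0..1} (\<lambda>x. max 0 (a - x)) = a\<^sup>2 / 2"
proof -
  have "((\<lambda>x. a - x) has_integral (a * a - a\<^sup>2 / 2) - (a * 0 - 0\<^sup>2 / 2)) {0..a}"
    using assms by (intro fundamental_theorem_of_calculus)
      (auto intro!: derivative_eq_intros simp flip: has_real_derivative_iff_has_vector_derivative)
  then have "((\<lambda>x. max 0 (a - x)) has_integral a\<^sup>2 / 2) {0..a}"
    by (rule has_integral_eq_rhs[OF has_integral_eq[rotated]]) (auto simp: power2_eq_square)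
  moreover have "((\<lambda>x. max 0 (a - x)) has_integral 0) {a..1}"
    by (rule has_integral_is_0) auto
  ultimately have "((\<lambda>x. max 0 (a - x)) has_integral a\<^sup>2 / 2 + 0) {0..1}"
    using assms by (intro has_integral_combine[of 0 a 1]) auto
  then show ?thesis
    by (simp add: integral_unique)
qed

lemma intg_opT:
  assumes f_in: "f \<in> classE" and f_continuous: "continuous_on {0..1} f"
  shows "intg f * intg (opT f) = integral {0..1} (\<lambda>t. (f t)\<^sup>2) / 2"
proof -
  have "continuous_on (cbox (0, 0) (1, 1)) (\<lambda>(x, t). max 0 (f t - x))"
    unfolding split_def cbox_Pair_eq
    by (intro continuous_intros continuous_on_compose2[OF f_continuous]) auto
  from integral_swap_continuous[OF this]
  have "integral {0..1} (excess f) = integral {0..1} (\<lambda>t. integral {0..1} (\<lambda>x. max 0 (f t - x)))"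
    by (simp add: excess_def[abs_def])
  also have "\<dots> = integral {0..1} (\<lambda>t. (f t)\<^sup>2 / 2)"
    using classE_nonneg[OF f_in] classE_le_1[OF f_in]
    by (intro Henstock_Kurzweil_Integration.integral_cong integral_hinge) auto
  finally have "integral {0..1} (excess f) = integral {0..1} (\<lambda>t. (f t)\<^sup>2) / 2"
    by simp
  moreover have "intg (opT f) = integral {0..1} (\<lambda>x. excess f x / intg f)"
    unfolding intg_def[of "opT f"]
    by (intro Henstock_Kurzweil_Integration.integral_cong opT_eq f_in)
  ultimately show ?thesis
    using classE_intg_pos[OF f_in] by simp
qed

text \<open>The comparison function is the maximum of \<open>l\<close> and the chord through \<open>(b, \<tau>)\<close> and \<open>(1, 0)\<close>,
  where \<open>g b = \<tau>\<close>. By convexity the chord lies between \<open>\<tau>\<close> and \<open>g\<close>.\<close>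

lemma convex_deviation_ge_max_chord:
  assumes g_in: "g \<in> classC_convex" and l_le_g: "\<And>x. x \<in> {0..1} \<Longrightarrow> l x \<le> g x"
    and \<tau>_bounds: "0 < \<tau>" "\<tau> < 1"
  shows "\<exists>c\<in>{0..1}. \<forall>x\<in>{0..1}. \<bar>max (l x) (c * (1 - x)) - \<tau>\<bar> \<le> \<bar>g x - \<tau>\<bar>"
proof -
  note g_convex = classC_convex_convex_on[OF g_in]
    and g_ends = classC_convex_at_0[OF g_in] classC_convex_at_1[OF g_in]
  obtain b where b_level: "0 \<le> b" "b \<le> 1" "g b = \<tau>"
    using IVT2'[of g 1 \<tau> 0] classC_convex_continuous_on[OF g_in] g_ends \<tau>_bounds by auto
  then have "b < 1"
    using g_ends \<tau>_bounds by (cases "b = 1") auto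
  have "\<tau> \<le> 1 - b"
    using convex_on_three_points[OF g_convex, of 0 1 b] b_level g_ends by simp
  define c where "c = \<tau> / (1 - b)"
  have c_slope: "0 \<le> c" "c \<le> 1" "c * (1 - b) = \<tau>"
    using \<open>\<tau> \<le> 1 - b\<close> \<open>b < 1\<close> \<tau>_bounds by (auto simp: c_def)
  show ?thesis
  proof (intro bexI[of _ c] ballI)
    fix x :: real assume x_in: "x \<in> {0..1}"
    show "\<bar>max (l x) (c * (1 - x)) - \<tau>\<bar> \<le> \<bar>g x - \<tau>\<bar>"
    proof (cases "x \<le> b")
      case True
      have "c * (1 - x) \<le> g x"
        using convex_on_three_points[OF g_convex, of x 1 b] True x_in b_level g_ends \<open>b < 1\<close>
        by (simp add: c_def field_simps)
      moreover have "\<tau> \<le> c * (1 - x)"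
        using True c_slope by (simp flip: c_slope(3) add: mult_left_mono)
      ultimately show ?thesis
        using l_le_g[OF x_in] by linarith
    next
      case False
      have "g x \<le> c * (1 - x)"
        using convex_on_three_points[OF g_convex, of b 1 x] False x_in b_level g_ends \<open>b < 1\<close>
        by (simp add: c_def field_simps)
      moreover have "c * (1 - x) \<le> \<tau>"
        using False c_slope by (simp flip: c_slope(3) add: mult_left_mono)
      ultimately show ?thesis
        using l_le_g[OF x_in] by linarith
    qed
  qed (use c_slope in simp)
qed

lemma has_integral_affine_square:
  fixes p q :: real
  assumes "a \<le> b" and u_eq: "p + q * a = u" and v_eq: "p + q * b = v"
  shows "((\<lambda>x. (p + q * x)\<^sup>2) has_integral (b - a) * (u\<^sup>2 + u * v + v\<^sup>2) / 3) {a..b}"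
proof -
  define P where "P x = p\<^sup>2 * x + p * q * x\<^sup>2 + q\<^sup>2 * x ^ 3 / 3" for x
  have "((\<lambda>x. (p + q * x)\<^sup>2) has_integral P b - P a) {a..b}"
    unfolding P_def using \<open>a \<le> b\<close>
    by (intro fundamental_theorem_of_calculus)
      (auto intro!: derivative_eq_intros simp: power2_eq_square algebra_simps
        simp flip: has_real_derivative_iff_has_vector_derivative)
  moreover have "P b - P a = (b - a) * (u\<^sup>2 + u * v + v\<^sup>2) / 3"
    unfolding P_def u_eq[symmetric] v_eq[symmetric]
    by (simp add: power2_eq_square power3_eq_cube field_simps)
  ultimately show ?thesis
    by simp
qed

lemma quadratic_nonneg:
  fixes a b c x :: real
  assumes "0 < a" "b\<^sup>2 \<le> 4 * a * c"
  shows "0 \<le> a * x\<^sup>2 - b * x + c"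
proof -
  have "4 * a * (a * x\<^sup>2 - b * x + c) = (2 * a * x - b)\<^sup>2 + (4 * a * c - b\<^sup>2)"
    by algebra
  also have "\<dots> \<ge> 0"
    using assms(2) by simp
  finally show ?thesis
    using \<open>0 < a\<close> by (simp add: zero_le_mult_iff)
qed

text \<open>After the substitution \<open>k = 5 + u\<close> the leading coefficient and the negated discriminant are
  polynomials in \<open>u\<close> with positive coefficients.\<close>

lemma broken_line_quadratic_nonneg:
  fixes c k :: real
  assumes "k \<ge> 5"
  shows "0 \<le> (k^3 - 3 * k\<^sup>2 + (303/50) * k - 306/50) * c\<^sup>2
    - ((153/50) * k\<^sup>2 - (206/50) * k - 153/50) * c + (k\<^sup>2 - (153/50) * k)"
    (is "0 \<le> ?A * c\<^sup>2 - ?B * c + ?C")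
proof (rule quadratic_nonneg)
  define u where "u = k - 5"
  have k_shift: "u \<ge> 0" "k = 5 + u"
    using assms by (auto simp: u_def)
  have "?A = 74.18 + 51.06 * u + 12 * u\<^sup>2 + u^3"
    unfolding k_shift(2) by (simp add: power2_eq_square power3_eq_cube field_simps)
  then show "0 < ?A"
    using k_shift(1) by (simp add: add_pos_nonneg)
  have "4 * ?A * ?C - ?B\<^sup>2
    = 86.1184 + 1241.9584 * u + 1155.1744 * u^2 + 414.1024 * u^3 + 66.3964 * u^4 + 4 * u^5"
    unfolding k_shift(2) by algebra
  also have "\<dots> \<ge> 0"
    using k_shift(1) by simp
  finally show "?B\<^sup>2 \<le> 4 * ?A * ?C"
    by simp
qed

definition broken_line :: "real \<Rightarrow> real \<Rightarrow> real \<Rightarrow> real" where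
  "broken_line k c x = max (1 - k * x) (c * (1 - x))"

definition kink :: "real \<Rightarrow> real \<Rightarrow> real" where
  "kink k c = (1 - c) / (k - c)"

definition kink_height :: "real \<Rightarrow> real \<Rightarrow> real" where
  "kink_height k c = c * (k - 1) / (k - c)"

lemma kink_height_eq:
  assumes "c < k"
  shows "1 - k * kink k c = kink_height k c" "c * (1 - kink k c) = kink_height k c"
  using assms by (auto simp: kink_def kink_height_def field_simps)

lemma
  assumes "c < k"
  shows broken_line_left: "x \<le> kink k c \<Longrightarrow> broken_line k c x = 1 - k * x"
    and broken_line_right: "kink k c \<le> x \<Longrightarrow> broken_line k c x = c * (1 - x)"
proof -
  have diff: "(1 - k * x) - c * (1 - x) = (k - c) * (kink k c - x)"
    using assms by (simp add: kink_def field_simps)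
  show "broken_line k c x = 1 - k * x" if "x \<le> kink k c"
  proof -
    have "0 \<le> (k - c) * (kink k c - x)"
      using assms that by simp
    then show ?thesis
      unfolding broken_line_def diff[symmetric] by simp
  qed
  show "broken_line k c x = c * (1 - x)" if "kink k c \<le> x"
  proof -
    have "(k - c) * (kink k c - x) \<le> 0"
      using assms that by (simp add: mult_nonneg_nonpos)
    then show ?thesis
      unfolding broken_line_def diff[symmetric] by simp
  qed
qed

lemma integral_broken_line_deviation:
  fixes c k \<tau> :: real
  assumes "1 \<le> k" "c \<le> 1" "c < k"
  defines "z \<equiv> kink k c" and "y \<equiv> kink_height k c"
  shows "integral {0..1} (\<lambda>x. (broken_line k c x - \<tau>)\<^sup>2)
    = \<tau>\<^sup>2 + ((z * (1 + y) + y\<^sup>2) / 3 - \<tau> * (z + y))"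
proof -
  have z_bounds: "0 \<le> z" "z \<le> 1"
    using assms(1-3) by (auto simp: z_def kink_def)
  have y_eqs: "1 - k * z = y" "c * (1 - z) = y"
    using kink_height_eq[OF \<open>c < k\<close>] by (simp_all add: z_def y_def)
  have "((\<lambda>x. ((1 - \<tau>) + (- k) * x)\<^sup>2) has_integral
      (z - 0) * ((1 - \<tau>)\<^sup>2 + (1 - \<tau>) * (y - \<tau>) + (y - \<tau>)\<^sup>2) / 3) {0..z}"
    using z_bounds y_eqs by (intro has_integral_affine_square) auto
  then have left: "((\<lambda>x. (broken_line k c x - \<tau>)\<^sup>2) has_integral
      (z - 0) * ((1 - \<tau>)\<^sup>2 + (1 - \<tau>) * (y - \<tau>) + (y - \<tau>)\<^sup>2) / 3) {0..z}"
    by (rule has_integral_eq[rotated])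
      (auto simp: broken_line_left[OF \<open>c < k\<close>] z_def algebra_simps)
  have "((\<lambda>x. ((c - \<tau>) + (- c) * x)\<^sup>2) has_integral
      (1 - z) * ((y - \<tau>)\<^sup>2 + (y - \<tau>) * (- \<tau>) + (- \<tau>)\<^sup>2) / 3) {z..1}"
    using z_bounds y_eqs by (intro has_integral_affine_square) (auto simp: algebra_simps)
  then have right: "((\<lambda>x. (broken_line k c x - \<tau>)\<^sup>2) has_integral
      (1 - z) * ((y - \<tau>)\<^sup>2 + (y - \<tau>) * (- \<tau>) + (- \<tau>)\<^sup>2) / 3) {z..1}"
    by (rule has_integral_eq[rotated])
      (auto simp: broken_line_right[OF \<open>c < k\<close>] z_def algebra_simps)
  show ?thesis
    using integral_unique[OF has_integral_combine[OF z_bounds left right]]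
    by (simp add: power2_eq_square field_simps)
qed

text \<open>The integrals of the broken line and of its square are \<open>(z + y) / 2\<close> and
  \<open>(z * (1 + y) + y\<^sup>2) / 3\<close>.\<close>

lemma broken_line_energy:
  fixes c k :: real
  assumes "k \<ge> 5" "c \<le> 1"
  defines "\<tau> \<equiv> (51/50) / k" and "z \<equiv> kink k c" and "y \<equiv> kink_height k c"
  shows "\<tau> * (z + y) \<le> (z * (1 + y) + y\<^sup>2) / 3"
proof -
  have pos: "k - c > 0" "k > 0"
    using assms(1,2) by auto
  have cleared_denominators: "(k - c) * z = 1 - c" "(k - c) * y = c * (k - 1)" "k * \<tau> = 51/50"
    using pos by (auto simp: z_def y_def kink_def kink_height_def \<tau>_def)
  have "0 \<le> (k^3 - 3 * k\<^sup>2 + (303/50) * k - 306/50) * c\<^sup>2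
      - ((153/50) * k\<^sup>2 - (206/50) * k - 153/50) * c + (k\<^sup>2 - (153/50) * k)"
    using \<open>k \<ge> 5\<close> by (rule broken_line_quadratic_nonneg)
  also have "\<dots> = k * ((1 - c) * ((k - c) + c * (k - 1)) + (c * (k - 1))\<^sup>2)
      - 3 * (51/50) * (k - c) * ((1 - c) + c * (k - 1))"
    by algebra
  also have "\<dots> = 3 * k * (k - c)\<^sup>2 * ((z * (1 + y) + y\<^sup>2) / 3 - \<tau> * (z + y))"
    unfolding cleared_denominators[symmetric] by (simp add: power2_eq_square field_simps)
  finally have "0 \<le> 3 * k * (k - c)\<^sup>2 * ((z * (1 + y) + y\<^sup>2) / 3 - \<tau> * (z + y))" .
  moreover have "0 < 3 * k * (k - c)\<^sup>2"
    using pos by simp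
  ultimately have "0 \<le> (z * (1 + y) + y\<^sup>2) / 3 - \<tau> * (z + y)"
    by (simp only: zero_le_mult_iff) linarith
  then show ?thesis
    by simp
qed

lemma broken_line_deviation_ge:
  assumes "k \<ge> 5" "c \<le> 1"
  shows "((51/50) / k)\<^sup>2 \<le> integral {0..1} (\<lambda>x. (broken_line k c x - (51/50) / k)\<^sup>2)"
  using broken_line_energy[OF assms] integral_broken_line_deviation[of k c "(51/50) / k"] assms
  by simp

lemma intg_opT_ge_stride:
  assumes g_in: "g \<in> classC_convex" and s_bounds: "0 < s" "s \<le> 1/5" "s \<le> stride g"
  shows "51/50 * s \<le> intg (opT g)"
proof -
  note g_classE = classC_convex_imp_classE[OF g_in]
    and g_continuous = classC_convex_continuous_on[OF g_in]
    and g_at_1 = classC_convex_at_1[OF g_in]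
  define k \<tau> where "k = 1 / s" and "\<tau> = (51/50) / k"
  have k_ge_5: "k \<ge> 5" and \<tau>_bounds: "\<tau> = 51/50 * s" "0 < \<tau>" "\<tau> < 1"
    using s_bounds by (auto simp: k_def \<tau>_def field_simps)
  have ray_le_g: "1 - k * x \<le> g x" if "x \<in> {0..1}" for x
    using stride_ge_iff[of g s] g_at_1 s_bounds that by (simp add: k_def)
  obtain c where c_in: "c \<in> {0..1}"
    and deviation_le: "\<And>x. x \<in> {0..1} \<Longrightarrow> \<bar>broken_line k c x - \<tau>\<bar> \<le> \<bar>g x - \<tau>\<bar>"
    using convex_deviation_ge_max_chord[of g "\<lambda>x. 1 - k * x", OF g_in ray_le_g \<tau>_bounds(2,3)]
    unfolding broken_line_def by blast
  have "\<tau>\<^sup>2 \<le> integral {0..1} (\<lambda>x. (broken_line k c x - \<tau>)\<^sup>2)"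
    unfolding \<tau>_def using k_ge_5 c_in by (intro broken_line_deviation_ge) auto
  also have "\<dots> \<le> integral {0..1} (\<lambda>x. (g x - \<tau>)\<^sup>2)"
    using deviation_le unfolding broken_line_def
    by (intro integral_le integrable_continuous_real continuous_intros g_continuous)
      (simp add: abs_le_square_iff)
  also have "\<dots> = integral {0..1} (\<lambda>x. (g x)\<^sup>2 - 2 * \<tau> * g x + \<tau>\<^sup>2)"
    by (simp add: power2_diff algebra_simps)
  also have "\<dots> = integral {0..1} (\<lambda>x. (g x)\<^sup>2) - 2 * \<tau> * intg g + \<tau>\<^sup>2"
    unfolding intg_def
    by (simp add: integral_add integral_diff integrable_add integrable_diff
        integrable_continuous_real continuous_intros g_continuous)
  also have "\<dots> = 2 * intg g * (intg (opT g) - \<tau>) + \<tau>\<^sup>2"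
    using intg_opT[OF g_classE g_continuous] by (simp add: algebra_simps)
  finally show ?thesis
    using classE_intg_pos[OF g_classE] \<tau>_bounds(1) by (simp add: zero_le_mult_iff)
qed

section \<open>Invariance and absorption\<close>

lemma classK_imp_classE: "g \<in> classK \<Longrightarrow> g \<in> classE"
  by (simp add: classK_def classC_convex_def classC_def)

lemma opT_in_classK:
  assumes g_in: "g \<in> classK"
  shows "opT g \<in> classK"
proof -
  have "1/5 \<le> stride (opT g)"
    using intg_le_stride_opT[OF classK_imp_classE[OF g_in]] g_in by (simp add: classK_def)
  moreover have "51/50 * (1/5) \<le> intg (opT g)"
    using g_in by (intro intg_opT_ge_stride) (auto simp: classK_def)
  ultimately show ?thesis
    using opT_in_classC_convex[OF classK_imp_classE[OF g_in]] by (simp add: classK_def)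
qed

lemma geometric_growth_reaches:
  fixes b :: "nat \<Rightarrow> real"
  assumes "0 < b 0" "1 < q" "0 < c" and growth: "\<And>n. q * min c (b n) \<le> b (Suc n)"
  obtains n where "c \<le> b n"
proof -
  define m where "m = min c (b 0)"
  have m_pos: "0 < m"
    using assms by (simp add: m_def)
  have lower_bound: "min c (q ^ n * m) \<le> b n" for n
  proof (induction n)
    case (Suc n)
    have "min c (q ^ Suc n * m) \<le> min (q * c) (q * (q ^ n * m))"
      using \<open>1 < q\<close> \<open>0 < c\<close> by (intro min.mono) (auto simp: mult.assoc)
    also have "\<dots> = q * min c (min c (q ^ n * m))"
      using \<open>1 < q\<close> by (simp add: min_mult_distrib_left)
    also have "\<dots> \<le> q * min c (b n)"
      using Suc.IH \<open>1 < q\<close> by (intro mult_left_mono min.mono) auto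
    also have "\<dots> \<le> b (Suc n)"
      by (rule growth)
    finally show ?case .
  qed (simp add: m_def)
  obtain n where "c / m < q ^ n"
    using real_arch_pow[OF \<open>1 < q\<close>] by blast
  then have "c \<le> q ^ n * m"
    using m_pos by (simp add: field_simps)
  then show thesis
    using lower_bound[of n] that by simp
qed

lemma opT_funpow_in_classE:
  assumes "f \<in> classE"
  shows "(opT ^^ n) f \<in> classE"
  by (induction n) (simp_all add: assms classC_convex_imp_classE[OF opT_in_classC_convex])

lemma intg_opT_opT_ge:
  assumes f_in: "f \<in> classE"
  shows "51/50 * min (1/5) (intg f) \<le> intg (opT (opT f))"
  using intg_le_stride_opT[OF f_in] classE_intg_pos[OF f_in]
  by (intro intg_opT_ge_stride opT_in_classC_convex f_in) auto

text \<open>The growth estimate spans two steps of the operator, so two consecutive iterates are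
  followed simultaneously.\<close>

lemma opT_funpow_reaches_classK:
  assumes f_in: "f \<in> classE"
  shows "\<exists>n\<ge>1. (opT ^^ n) f \<in> classK"
proof -
  define F where "F n = (opT ^^ n) f" for n
  have F_in: "F n \<in> classE" and F_Suc: "F (Suc n) = opT (F n)" for n
    using opT_funpow_in_classE[OF f_in] by (simp_all add: F_def)
  define b where "b n = min (intg (F (2 * n))) (intg (F (Suc (2 * n))))" for n
  have growth: "51/50 * min (1/5) (b n) \<le> b (Suc n)" for n
    using intg_opT_opT_ge[OF F_in, of "2 * n"] intg_opT_opT_ge[OF F_in, of "Suc (2 * n)"]
    by (auto simp: b_def F_Suc)
  have "0 < b 0"
    using classE_intg_pos[OF F_in] by (simp add: b_def)
  then obtain n where "1/5 \<le> b n"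
    using geometric_growth_reaches[of b "51/50" "1/5"] growth by auto
  then have "1/5 \<le> stride (F (Suc (2 * n)))" "1/5 \<le> intg (F (Suc (2 * n)))"
    using intg_le_stride_opT[OF F_in, of "2 * n"] by (auto simp: b_def F_Suc)
  then have "F (Suc (2 * n)) \<in> classK"
    using opT_in_classC_convex[OF F_in] by (simp add: classK_def F_Suc)
  then show ?thesis
    unfolding F_def by (intro exI[of _ "Suc (2 * n)"]) simp
qed

section \<open>Comparison of the two metrics\<close>

lemma abs_diff_le_1:
  assumes "f \<in> classE" "g \<in> classE" "x \<in> {0..1}"
  shows "\<bar>f x - g x\<bar> \<le> 1"
  using classE_nonneg[OF assms(1,3)] classE_le_1[OF assms(1,3)]
    classE_nonneg[OF assms(2,3)] classE_le_1[OF assms(2,3)] by linarith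

lemma abs_diff_integrable:
  assumes "f \<in> classE" "g \<in> classE"
  shows "(\<lambda>x. \<bar>f x - g x\<bar>) integrable_on {0..1}"
proof -
  have "f absolutely_integrable_on {0..1}" "g absolutely_integrable_on {0..1}"
    using assms by (auto intro: nonnegative_absolutely_integrable_1 classE_integrable classE_nonneg)
  then have "(\<lambda>x. f x - g x) absolutely_integrable_on {0..1}"
    by (rule set_integral_diff)
  then show ?thesis
    by (simp add: absolutely_integrable_on_def)
qed

lemma abs_diff_le_d_inf:
  assumes "f \<in> classE" "g \<in> classE" "x \<in> {0..1}"
  shows "\<bar>f x - g x\<bar> \<le> d_inf f g"
  unfolding d_inf_def using abs_diff_le_1[OF assms(1,2)] assms(3)
  by (intro cSup_upper) (auto intro!: bdd_aboveI[of _ 1])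

lemma d_inf_le:
  assumes "\<And>x. x \<in> {0..1} \<Longrightarrow> \<bar>f x - g x\<bar> \<le> c"
  shows "d_inf f g \<le> c"
  unfolding d_inf_def using assms by (intro cSup_least) auto

lemma d_inf_triangle:
  assumes "f \<in> classE" "g \<in> classE" "h \<in> classE"
  shows "d_inf f h \<le> d_inf f g + d_inf g h"
proof (rule d_inf_le)
  fix x :: real assume "x \<in> {0..1}"
  then show "\<bar>f x - h x\<bar> \<le> d_inf f g + d_inf g h"
    using abs_diff_le_d_inf[OF assms(1,2), of x] abs_diff_le_d_inf[OF assms(2,3), of x]
    by linarith
qed

lemma d_1_nonneg:
  assumes "f \<in> classE" "g \<in> classE"
  shows "0 \<le> d_1 f g"
  unfolding d_1_def using abs_diff_integrable[OF assms] by (intro integral_nonneg) auto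

lemma d_1_triangle:
  assumes "f \<in> classE" "g \<in> classE" "h \<in> classE"
  shows "d_1 f h \<le> d_1 f g + d_1 g h"
proof -
  have "d_1 f h \<le> integral {0..1} (\<lambda>x. \<bar>f x - g x\<bar> + \<bar>g x - h x\<bar>)"
    unfolding d_1_def by (intro integral_le integrable_add abs_diff_integrable assms) auto
  also have "\<dots> = d_1 f g + d_1 g h"
    unfolding d_1_def by (intro integral_add abs_diff_integrable assms)
  finally show ?thesis .
qed

lemma d_1_le_d_inf:
  assumes "f \<in> classE" "g \<in> classE"
  shows "d_1 f g \<le> d_inf f g"
proof -
  have "d_1 f g \<le> integral {0..1} (\<lambda>x::real. d_inf f g)"
    unfolding d_1_def using abs_diff_integrable[OF assms] abs_diff_le_d_inf[OF assms]
    by (intro integral_le) auto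
  then show ?thesis
    by simp
qed

lemma d_inf_nonneg:
  assumes "f \<in> classE" "g \<in> classE"
  shows "0 \<le> d_inf f g"
  using d_1_nonneg[OF assms] d_1_le_d_inf[OF assms] by simp

lemma d_inf_le_sqrt_d_1_stride:
  assumes f_stride: "f \<in> classC_convex" "s \<le> stride f"
    and g_stride: "g \<in> classC_convex" "s \<le> stride g"
    and s_bounds: "0 < s" "s \<le> 1"
  shows "d_inf f g \<le> sqrt (4 / s * d_1 f g)"
proof (rule d_inf_le)
  fix x :: real assume x_in: "x \<in> {0..1}"
  note in_classE = classC_convex_imp_classE[OF f_stride(1)]
    classC_convex_imp_classE[OF g_stride(1)]
  have "(1 / s)-lipschitz_on {0..1} (\<lambda>x. f x - g x)"
    using in_classE[THEN classE_decreasing01] f_stride g_stride s_bounds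
    unfolding decreasing01_iff_antimono_on
    by (intro lipschitz_on_diff_antimono classC_convex_lipschitz)
  moreover have "\<bar>f x - g x\<bar> \<le> 1 / s"
    using abs_diff_le_1[OF in_classE x_in] s_bounds by (simp add: order_trans[of _ 1])
  ultimately have "(f x - g x)\<^sup>2 \<le> 4 * (1 / s) * d_1 f g"
    unfolding d_1_def using s_bounds x_in by (intro lipschitz_on_square_le_integral) auto
  then show "\<bar>f x - g x\<bar> \<le> sqrt (4 / s * d_1 f g)"
    by (intro real_le_rsqrt) simp
qed

lemma d_inf_le_sqrt_d_1:
  assumes "f \<in> classK" "g \<in> classK"
  shows "d_inf f g \<le> 5 * sqrt (d_1 f g)"
proof -
  have "d_inf f g \<le> sqrt (4 / (1/5) * d_1 f g)"
    using assms by (intro d_inf_le_sqrt_d_1_stride) (auto simp: classK_def)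
  also have "\<dots> \<le> sqrt (5\<^sup>2 * d_1 f g)"
    using d_1_nonneg[OF assms[THEN classK_imp_classE]] by simp
  also have "\<dots> = 5 * sqrt (d_1 f g)"
    by (simp add: real_sqrt_mult)
  finally show ?thesis .
qed

section \<open>Continuity of the operator\<close>

lemma excess_diff_le_d_1:
  assumes "f \<in> classE" "g \<in> classE"
  shows "\<bar>excess f x - excess g x\<bar> \<le> d_1 f g"
proof -
  have "excess f x - excess g x = integral {0..1} (\<lambda>t. max 0 (f t - x) - max 0 (g t - x))"
    unfolding excess_def by (intro integral_diff[symmetric] excess_integrable assms)
  also have "norm \<dots> \<le> d_1 f g"
    unfolding d_1_def
    by (intro integral_norm_bound_integral integrable_diff excess_integrable abs_diff_integrable
        assms) auto
  finally show ?thesis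
    by simp
qed

lemma d_inf_opT_le_d_1:
  assumes f_in: "f \<in> classE" and g_in: "g \<in> classE"
  shows "d_inf (opT f) (opT g) \<le> 2 / intg f * d_1 f g"
proof (rule d_inf_le)
  fix x :: real assume x_in: "x \<in> {0..1}"
  have intg_pos: "intg f > 0" "intg g > 0"
    using f_in g_in by (auto intro: classE_intg_pos)
  have "\<bar>opT g x * (intg g - intg f)\<bar> \<le> 1 * d_1 f g"
    unfolding abs_mult
  proof (rule mult_mono)
    show "\<bar>opT g x\<bar> \<le> 1"
      using classC_convex_imp_classE[OF opT_in_classC_convex[OF g_in]] x_in
      by (simp add: classE_nonneg classE_le_1)
    show "\<bar>intg g - intg f\<bar> \<le> d_1 f g"
      using excess_diff_le_d_1[OF f_in g_in, of 0]
      by (simp add: excess_0 f_in g_in abs_minus_commute)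
  qed auto
  then have "\<bar>(excess f x - excess g x) + opT g x * (intg g - intg f)\<bar> \<le> 2 * d_1 f g"
    using excess_diff_le_d_1[OF f_in g_in, of x] by linarith
  moreover have "intg f * (opT f x - opT g x)
      = (excess f x - excess g x) + opT g x * (intg g - intg f)"
    using intg_pos by (simp add: opT_eq[OF f_in x_in] opT_eq[OF g_in x_in] field_simps)
  ultimately have "intg f * \<bar>opT f x - opT g x\<bar> \<le> 2 * d_1 f g"
    using intg_pos by (metis abs_mult abs_of_pos)
  then show "\<bar>opT f x - opT g x\<bar> \<le> 2 / intg f * d_1 f g"
    using intg_pos by (simp add: field_simps)
qed

lemma d_inf_opT_le_on_classK:
  assumes f_in: "f \<in> classK" and g_in: "g \<in> classK"
  shows "d_inf (opT f) (opT g) \<le> 10 * d_1 f g"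
proof -
  note in_classE = classK_imp_classE[OF f_in] classK_imp_classE[OF g_in]
  have "1/5 \<le> intg f"
    using f_in by (simp add: classK_def)
  then have "2 / intg f \<le> 10"
    by (simp add: field_simps)
  then show ?thesis
    using d_inf_opT_le_d_1[OF in_classE]
      mult_right_mono[OF _ d_1_nonneg[OF in_classE], of "2 / intg f" 10] by linarith
qed

lemma continuous_wrt_if_lipschitz:
  assumes "0 < L" and lipschitz_bound: "\<And>f g. f \<in> S \<Longrightarrow> g \<in> S \<Longrightarrow> db (F f) (F g) \<le> L * da f g"
  shows "continuous_wrt S da db F"
  unfolding continuous_wrt_def
proof (intro ballI allI impI)
  fix f and e :: real assume f_in: "f \<in> S" and "e > 0"
  show "\<exists>\<delta>>0. \<forall>g\<in>S. da f g < \<delta> \<longrightarrow> db (F f) (F g) < e"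
  proof (intro exI[of _ "e / L"] conjI ballI impI)
    show "0 < e / L"
      using \<open>e > 0\<close> \<open>0 < L\<close> by simp
    fix g assume g_in: "g \<in> S" and "da f g < e / L"
    then have "L * da f g < e"
      using \<open>0 < L\<close> by (simp add: field_simps)
    then show "db (F f) (F g) < e"
      using lipschitz_bound[OF f_in g_in] by simp
  qed
qed

lemma continuous_wrt_opT:
  assumes "da \<in> {d_inf, d_1}" "db \<in> {d_inf, d_1}"
  shows "continuous_wrt classK da db opT"
proof (rule continuous_wrt_if_lipschitz)
  fix f g assume in_classK: "f \<in> classK" "g \<in> classK"
  note images_in_classK = in_classK[THEN opT_in_classK]
  have "db (opT f) (opT g) \<le> d_inf (opT f) (opT g)"
    using assms(2) d_1_le_d_inf[OF images_in_classK[THEN classK_imp_classE]] by auto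
  also have "\<dots> \<le> 10 * d_1 f g"
    using in_classK by (rule d_inf_opT_le_on_classK)
  also have "\<dots> \<le> 10 * da f g"
    using assms(1) d_1_le_d_inf[OF in_classK[THEN classK_imp_classE]] by auto
  finally show "db (opT f) (opT g) \<le> 10 * da f g" .
qed simp

section \<open>Compactness and completeness\<close>

lemma complete_wrt_if_seq_compact_wrt:
  assumes compactness: "seq_compact_wrt S d"
    and nonneg: "\<And>f g. f \<in> S \<Longrightarrow> g \<in> S \<Longrightarrow> 0 \<le> d f g"
    and triangle: "\<And>f g h. f \<in> S \<Longrightarrow> g \<in> S \<Longrightarrow> h \<in> S \<Longrightarrow> d f h \<le> d f g + d g h"
  shows "complete_wrt S d"
  unfolding complete_wrt_def
proof (intro allI impI, elim conjE)
  fix u :: "nat \<Rightarrow> real \<Rightarrow> real"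
  assume u_in: "\<forall>n. u n \<in> S" and cauchy: "\<forall>e>0. \<exists>N. \<forall>m\<ge>N. \<forall>n\<ge>N. d (u m) (u n) < e"
  obtain r :: "nat \<Rightarrow> nat" and g where r_mono: "strict_mono r" and g_in: "g \<in> S"
    and lim: "(\<lambda>n. d (u (r n)) g) \<longlonglongrightarrow> 0"
    using compactness u_in unfolding seq_compact_wrt_def by blast
  have "(\<lambda>n. d (u n) g) \<longlonglongrightarrow> 0"
  proof (rule LIMSEQ_I)
    fix e :: real assume "e > 0"
    then obtain N where N_bound: "\<And>m n. m \<ge> N \<Longrightarrow> n \<ge> N \<Longrightarrow> d (u m) (u n) < e / 2"
      using cauchy[rule_format, of "e / 2"] by auto
    have "\<forall>\<^sub>F k in sequentially. k \<ge> N \<and> d (u (r k)) g < e / 2"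
      using eventually_ge_at_top order_tendstoD(2)[OF lim, of "e / 2"] \<open>e > 0\<close>
      by (intro eventually_conj) auto
    then obtain k where k_bounds: "k \<ge> N" "d (u (r k)) g < e / 2"
      by (auto simp: eventually_sequentially)
    then have "r k \<ge> N"
      using seq_suble[OF r_mono, of k] by simp
    have "norm (d (u n) g - 0) < e" if "n \<ge> N" for n
    proof -
      have "d (u n) g \<le> d (u n) (u (r k)) + d (u (r k)) g"
        using u_in g_in by (intro triangle) auto
      then show ?thesis
        using N_bound[OF that \<open>r k \<ge> N\<close>] k_bounds(2) nonneg[of "u n" g] u_in g_in by simp
    qed
    then show "\<exists>N. \<forall>n\<ge>N. norm (d (u n) g - 0) < e"
      by blast
  qed
  then show "\<exists>g\<in>S. (\<lambda>n. d (u n) g) \<longlonglongrightarrow> 0"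
    using g_in by blast
qed

lemma seq_compact_wrt_mono:
  assumes compactness: "seq_compact_wrt S d"
    and d'_bounds: "\<And>f g. f \<in> S \<Longrightarrow> g \<in> S \<Longrightarrow> 0 \<le> d' f g \<and> d' f g \<le> d f g"
  shows "seq_compact_wrt S d'"
  unfolding seq_compact_wrt_def
proof (intro allI impI)
  fix u :: "nat \<Rightarrow> real \<Rightarrow> real" assume u_in: "\<forall>n. u n \<in> S"
  then obtain r :: "nat \<Rightarrow> nat" and g where r_mono: "strict_mono r" and g_in: "g \<in> S"
    and lim: "(\<lambda>n. d (u (r n)) g) \<longlonglongrightarrow> 0"
    using compactness unfolding seq_compact_wrt_def by blast
  have "(\<lambda>n. d' (u (r n)) g) \<longlonglongrightarrow> 0"
    by (rule tendsto_sandwich[OF _ _ tendsto_const lim]) (use u_in g_in d'_bounds in auto)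
  then show "\<exists>(r::nat\<Rightarrow>nat) g. strict_mono r \<and> g \<in> S \<and> (\<lambda>n. d' (u (r n)) g) \<longlonglongrightarrow> 0"
    using r_mono g_in by blast
qed

lemma decreasing01_LIMSEQ:
  assumes "\<And>n. decreasing01 (u n)" and lim: "\<And>x. x \<in> {0..1} \<Longrightarrow> (\<lambda>n. u n x) \<longlonglongrightarrow> g x"
  shows "decreasing01 g"
  unfolding decreasing01_def
proof (intro ballI impI)
  fix x y :: real assume "x \<in> {0..1}" "y \<in> {0..1}" "x \<le> y"
  then show "g y \<le> g x"
    using assms(1) by (intro LIMSEQ_le[OF lim lim]) (auto simp: decreasing01_def)
qed

lemma convex_on_LIMSEQ:
  assumes convex: "\<And>n. convex_on S (u n)" and lim: "\<And>x. x \<in> S \<Longrightarrow> (\<lambda>n. u n x) \<longlonglongrightarrow> g x"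
  shows "convex_on S g"
proof (rule convex_onI)
  show convex_S: "convex S"
    using convex by (rule convex_on_imp_convex)
  fix t :: real and x y assume t_bounds: "0 < t" "t < 1" and xy_in: "x \<in> S" "y \<in> S"
  have "(1 - t) *\<^sub>R x + t *\<^sub>R y \<in> S"
    using convex_S xy_in t_bounds by (intro convexD_alt) auto
  moreover have "(\<lambda>n. (1 - t) * u n x + t * u n y) \<longlonglongrightarrow> (1 - t) * g x + t * g y"
    by (intro tendsto_intros lim xy_in)
  ultimately show "g ((1 - t) *\<^sub>R x + t *\<^sub>R y) \<le> (1 - t) * g x + t * g y"
    using convex_onD[OF convex, of t x y] t_bounds xy_in by (intro LIMSEQ_le[OF lim]) auto
qed

lemma intg_uniform_limit:
  assumes "uniform_limit {0..1} u g sequentially" "\<And>n. continuous_on {0..1} (u n)"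
  shows "(\<lambda>n. intg (u n)) \<longlonglongrightarrow> intg g"
proof -
  obtain I J where "\<And>n. (u n has_integral I n) {0..1}" "(g has_integral J) {0..1}" "I \<longlonglongrightarrow> J"
    using uniform_limit_integral[OF assms] by (metis sequentially_bot)
  moreover from this have "intg (u n) = I n" "intg g = J" for n
    by (simp_all add: intg_def integral_unique)
  ultimately show ?thesis
    by simp
qed

lemma classC_convex_uniform_limit:
  assumes u_in: "\<And>n. u n \<in> classC_convex" and lim: "uniform_limit {0..1} u g sequentially"
  shows "g \<in> classC_convex"
proof -
  note u_classE = classC_convex_imp_classE[OF u_in]
    and u_continuous = classC_convex_continuous_on[OF u_in]
    and u_convex = classC_convex_convex_on[OF u_in]
    and u_at_0 = classC_convex_at_0[OF u_in]
    and u_at_1 = classC_convex_at_1[OF u_in]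
  have pointwise: "(\<lambda>n. u n x) \<longlonglongrightarrow> g x" if "x \<in> {0..1}" for x
    using lim that by (rule tendsto_uniform_limitI)
  have "decreasing01 g"
    using classE_decreasing01[OF u_classE] pointwise by (rule decreasing01_LIMSEQ)
  moreover have "convex_on {0..1} g"
    using u_convex pointwise by (rule convex_on_LIMSEQ)
  moreover have "continuous_on {0..1} g"
    using u_continuous by (intro uniform_limit_theorem[OF _ lim]) auto
  moreover have "g 0 = 1" "g 1 = 0"
    using pointwise[of 0] pointwise[of 1] by (simp_all add: u_at_0 u_at_1 LIMSEQ_const_iff)
  ultimately show ?thesis
    by (simp add: classC_convex_def classC_iff)
qed

lemma classK_uniform_limit:
  assumes u_in: "\<And>n. u n \<in> classK" and lim: "uniform_limit {0..1} u g sequentially"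
  shows "g \<in> classK"
proof -
  have u_convex: "u n \<in> classC_convex" and u_stride: "1/5 \<le> stride (u n)"
    and u_intg: "1/5 \<le> intg (u n)" for n
    using u_in by (simp_all add: classK_def)
  have g_in: "g \<in> classC_convex"
    using u_convex lim by (rule classC_convex_uniform_limit)
  have "1 - x / (1/5) \<le> g x" if x_in: "x \<in> {0..1}" for x
  proof (rule LIMSEQ_le_const)
    show "(\<lambda>n. u n x) \<longlonglongrightarrow> g x"
      using lim x_in by (rule tendsto_uniform_limitI)
    show "\<exists>N. \<forall>n\<ge>N. 1 - x / (1/5) \<le> u n x"
      using u_stride stride_ge_iff[of "u _" "1/5"] classC_convex_at_1[OF u_convex] x_in by auto
  qed
  then have "1/5 \<le> stride g"
    using stride_ge_iff[of g "1/5"] classC_convex_at_1[OF g_in] by simp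
  moreover have "1/5 \<le> intg g"
    using intg_uniform_limit[OF lim classC_convex_continuous_on[OF u_convex]] u_intg
    by (intro LIMSEQ_le_const) auto
  ultimately show ?thesis
    using g_in by (simp add: classK_def)
qed

lemma d_inf_tendsto_0_if_uniform_limit:
  assumes u_in: "\<And>n. u n \<in> classE" and g_in: "g \<in> classE"
    and lim: "uniform_limit {0..1} u g sequentially"
  shows "(\<lambda>n. d_inf (u n) g) \<longlonglongrightarrow> 0"
proof (rule tendstoI)
  fix e :: real assume "0 < e"
  then have "\<forall>\<^sub>F n in sequentially. \<forall>x\<in>{0..1}. dist (u n x) (g x) < e / 2"
    using lim by (intro uniform_limitD) auto
  then show "\<forall>\<^sub>F n in sequentially. dist (d_inf (u n) g) 0 < e"
  proof eventually_elim
    case (elim n)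
    then have "d_inf (u n) g \<le> e / 2"
      by (intro d_inf_le) (force simp: dist_real_def)
    then show ?case
      using d_inf_nonneg[OF u_in g_in, of n] \<open>0 < e\<close> by (simp add: dist_real_def)
  qed
qed

lemma lipschitz_uniformly_convergent_subseq:
  fixes u :: "nat \<Rightarrow> 'a::euclidean_space \<Rightarrow> 'b::{real_normed_vector,heine_borel}"
  assumes "compact S" and lipschitz: "\<And>n. L-lipschitz_on S (u n)"
    and bound: "\<And>n x. x \<in> S \<Longrightarrow> norm (u n x) \<le> M"
  obtains g r where "strict_mono (r :: nat \<Rightarrow> nat)" "uniform_limit S (\<lambda>n. u (r n)) g sequentially"
proof -
  have "L \<ge> 0"
    using lipschitz by (rule lipschitz_on_nonneg)
  have equicont: "\<exists>d>0. \<forall>n y. y \<in> S \<and> norm (x - y) < d \<longrightarrow> norm (u n x - u n y) < e"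
    if x_in: "x \<in> S" and "0 < e" for x e
  proof (intro exI[of _ "e / (L + 1)"] conjI allI impI)
    fix n y assume y_in: "y \<in> S \<and> norm (x - y) < e / (L + 1)"
    have "norm (u n x - u n y) \<le> L * norm (x - y)"
      using lipschitz_onD[OF lipschitz x_in, of y n] y_in by (simp add: dist_norm)
    also have "\<dots> \<le> (L + 1) * norm (x - y)"
      by (intro mult_right_mono) auto
    also have "\<dots> < e"
      using y_in \<open>L \<ge> 0\<close> by (simp add: field_simps)
    finally show "norm (u n x - u n y) < e" .
  qed (use \<open>0 < e\<close> \<open>L \<ge> 0\<close> in auto)
  show thesis
  proof (rule Arzela_Ascoli[OF \<open>compact S\<close> bound equicont])
    fix g and r :: "nat \<Rightarrow> nat"
    assume r_mono: "strict_mono r"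
      and "\<And>e. 0 < e \<Longrightarrow> \<exists>N. \<forall>n x. n \<ge> N \<and> x \<in> S \<longrightarrow> norm (u (r n) x - g x) < e"
    then have "uniform_limit S (\<lambda>n. u (r n)) g sequentially"
      unfolding uniform_limit_sequentially_iff dist_norm by metis
    with r_mono show thesis
      by (rule that)
  qed auto
qed

lemma seq_compact_wrt_classK_d_inf: "seq_compact_wrt classK d_inf"
  unfolding seq_compact_wrt_def
proof (intro allI impI)
  fix u :: "nat \<Rightarrow> real \<Rightarrow> real" assume "\<forall>n. u n \<in> classK"
  then have u_in: "u n \<in> classK" for n
    by blast
  note u_classE = classK_imp_classE[OF u_in]
  have lipschitz: "(1 / (1/5))-lipschitz_on {0..1} (u n)" for n
    using u_in by (intro classC_convex_lipschitz) (auto simp: classK_def)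
  have bound: "norm (u n x) \<le> 1" if "x \<in> {0..1}" for n x
    using classE_nonneg[OF u_classE that] classE_le_1[OF u_classE that] by simp
  obtain g and r :: "nat \<Rightarrow> nat" where r_mono: "strict_mono r"
    and uniform: "uniform_limit {0..1} (\<lambda>n. u (r n)) g sequentially"
    by (rule lipschitz_uniformly_convergent_subseq[OF compact_Icc lipschitz bound])
  have g_in: "g \<in> classK"
    using u_in uniform by (rule classK_uniform_limit)
  have "(\<lambda>n. d_inf (u (r n)) g) \<longlonglongrightarrow> 0"
    using u_classE classK_imp_classE[OF g_in] uniform by (rule d_inf_tendsto_0_if_uniform_limit)
  then show "\<exists>(r::nat\<Rightarrow>nat) g. strict_mono r \<and> g \<in> classK \<and> (\<lambda>n. d_inf (u (r n)) g) \<longlonglongrightarrow> 0"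
    using r_mono g_in by blast
qed

lemma seq_compact_wrt_classK_d_1: "seq_compact_wrt classK d_1"
  using seq_compact_wrt_classK_d_inf
  by (rule seq_compact_wrt_mono) (simp add: d_1_nonneg d_1_le_d_inf classK_imp_classE)

theorem theorem2p5:
  shows "opT ` classK \<subseteq> classK \<inter> classD_sharp_convex
    \<and> (\<forall>f\<in>classE. \<exists>n::nat. n \<ge> 1 \<and> (opT ^^ n) f \<in> classK)
    \<and> (\<forall>f\<in>classK. \<forall>g\<in>classK. d_1 f g \<le> d_inf f g \<and> d_inf f g \<le> 5 * sqrt (d_1 f g))
    \<and> (complete_wrt classK d_inf \<and> complete_wrt classK d_1)
    \<and> (\<forall>da\<in>{d_inf, d_1}. \<forall>db\<in>{d_inf, d_1}. continuous_wrt classK da db opT)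
    \<and> (seq_compact_wrt classK d_inf \<and> seq_compact_wrt classK d_1)"
proof (intro conjI)
  show "opT ` classK \<subseteq> classK \<inter> classD_sharp_convex"
    using opT_in_classK opT_in_classD_sharp_convex by (auto simp: classK_def)
  show "\<forall>f\<in>classE. \<exists>n::nat. n \<ge> 1 \<and> (opT ^^ n) f \<in> classK"
    using opT_funpow_reaches_classK by blast
  show "\<forall>f\<in>classK. \<forall>g\<in>classK. d_1 f g \<le> d_inf f g \<and> d_inf f g \<le> 5 * sqrt (d_1 f g)"
    using d_1_le_d_inf classK_imp_classE d_inf_le_sqrt_d_1 by blast
  show "complete_wrt classK d_inf"
    using seq_compact_wrt_classK_d_inf
    by (rule complete_wrt_if_seq_compact_wrt)
      (blast intro: d_inf_nonneg d_inf_triangle classK_imp_classE)+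
  show "complete_wrt classK d_1"
    using seq_compact_wrt_classK_d_1
    by (rule complete_wrt_if_seq_compact_wrt)
      (blast intro: d_1_nonneg d_1_triangle classK_imp_classE)+
  show "\<forall>da\<in>{d_inf, d_1}. \<forall>db\<in>{d_inf, d_1}. continuous_wrt classK da db opT"
    using continuous_wrt_opT by blast
  show "seq_compact_wrt classK d_inf" "seq_compact_wrt classK d_1"
    by (fact seq_compact_wrt_classK_d_inf seq_compact_wrt_classK_d_1)+
qed

end
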